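(* Let $(\Gamma,L)$ be a periodic graph and let $x_0\in V_\Gamma$. Let $L'<L$ be a subgroup and let $V'\subset V_\Gamma$ be a finitely generated $L'$-submodule. Then the function $\mathbb Z_{\ge0}\to\mathbb Z_{\ge0}$, $i\mapsto\#\{y\in V': d_\Gamma(x_0,y)\le i\}$, is of quasi-polynomial type.
   Context: A graph is a directed graph (loops/multiple edges allowed) with source/target maps and edge weights in $\mathbb Z_{>0}$; $d_\Gamma(x,y)$ is the minimum total weight of a walk from $x$ to $y$ ($\infty$ if none). A periodic graph $(\Gamma,L)$ consists of a graph $\Gamma$ and a free abelian group $L\cong\mathbb Z^n$ acting freely on vertices and edges with finitely many orbits on each, compatibly with source, target and weight. A finitely generated $L'$-submodule of $V_\Gamma$ is a subset $V'$ with $L'+V'\subset V'$ and $V'=L'+F$ for some finite $F\subset V'$. A function $g:\mathbb Z_{\ge0}\to\mathbb C$ is of quasi-polynomial type if there are $M\ge0$, $N\ge1$ and polynomials $Q_0,\dots,Q_{N-1}$ with $g(m)=Q_j(m)$ for all $m>M$ with $m\equiv j\pmod N$. *)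

theory Defs
  imports
    "Graph_Theory.Shortest_Path"
    "HOL-Algebra.Group_Action"
    "HOL-Algebra.Product_Groups"
    "HOL-Number_Theory.Cong"
    "HOL-Computational_Algebra.Polynomial"
    Complex_Main
begin

text \<open>
  The group \<open>L\<close> is written multiplicatively, as usual in HOL-Algebra; its actions on the
  vertices and on the arcs are \<open>\<phi>\<close> and \<open>\<psi>\<close>. The rank \<open>n\<close> may be any natural number.
\<close>

locale periodic_graph =
    wf_digraph \<Gamma> +
    verts_action: group_action L "verts \<Gamma>" \<phi> +
    arcs_action: group_action L "arcs \<Gamma>" \<psi>
  for \<Gamma> :: "('v, 'e) pre_digraph"
    and w :: "'e \<Rightarrow> nat"
    and L :: "('l, 'm) monoid_scheme"
    and \<phi> :: "'l \<Rightarrow> 'v \<Rightarrow> 'v"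
    and \<psi> :: "'l \<Rightarrow> 'e \<Rightarrow> 'e" +
  assumes weight_pos: "e \<in> arcs \<Gamma> \<Longrightarrow> 0 < w e"
    and free_abelian: "\<exists>n::nat. L \<cong> product_group {..<n} (\<lambda>_. integer_group)"
    and verts_free: "x \<in> verts \<Gamma> \<Longrightarrow> stabilizer L \<phi> x = {\<one>\<^bsub>L\<^esub>}"
    and arcs_free: "e \<in> arcs \<Gamma> \<Longrightarrow> stabilizer L \<psi> e = {\<one>\<^bsub>L\<^esub>}"
    and verts_orbits: "finite (orbits L (verts \<Gamma>) \<phi>)"
    and arcs_orbits: "finite (orbits L (arcs \<Gamma>) \<psi>)"
    and tail_compat: "u \<in> carrier L \<Longrightarrow> e \<in> arcs \<Gamma> \<Longrightarrow> tail \<Gamma> (\<psi> u e) = \<phi> u (tail \<Gamma> e)"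
    and head_compat: "u \<in> carrier L \<Longrightarrow> e \<in> arcs \<Gamma> \<Longrightarrow> head \<Gamma> (\<psi> u e) = \<phi> u (head \<Gamma> e)"
    and weight_compat: "u \<in> carrier L \<Longrightarrow> e \<in> arcs \<Gamma> \<Longrightarrow> w (\<psi> u e) = w e"

text \<open>
  The library distance is an infimum over walks. As weights are natural numbers, it is a minimum
  as soon as a walk exists (lemma \<open>graph_dist_attained\<close>), and it is \<open>\<infinity>\<close> otherwise.
\<close>

definition graph_dist :: "('v, 'e) pre_digraph \<Rightarrow> ('e \<Rightarrow> nat) \<Rightarrow> 'v \<Rightarrow> 'v \<Rightarrow> ereal" where
  "graph_dist \<Gamma> w x y = wf_digraph.\<mu> \<Gamma> (\<lambda>e. real (w e)) x y"

lemma graph_dist_no_walk: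
  assumes "wf_digraph \<Gamma>" "\<nexists>p. pre_digraph.awalk \<Gamma> x p y"
  shows "graph_dist \<Gamma> w x y = \<infinity>"
  using assms by (simp add: graph_dist_def wf_digraph.\<mu>_def top_ereal_def)

lemma graph_dist_attained:
  assumes "wf_digraph \<Gamma>" "pre_digraph.awalk \<Gamma> x p y"
  shows "\<exists>q. pre_digraph.awalk \<Gamma> x q y \<and> graph_dist \<Gamma> w x y = ereal (real (sum_list (map w q)))"
proof -
  interpret wf_digraph \<Gamma> by fact
  have cost: "awalk_cost (\<lambda>e. real (w e)) q = real (sum_list (map w q))" for q
    by (induction q) (auto simp: awalk_cost_def)
  define q where "q = arg_min (\<lambda>q. sum_list (map w q)) (\<lambda>q. awalk x q y)"
  note am = arg_min_nat_lemma[of "\<lambda>q. awalk x q y" p "\<lambda>q. sum_list (map w q)",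
      OF assms(2), folded q_def]
  have q: "awalk x q y" using am by (rule conjunct1)
  have le: "sum_list (map w q) \<le> sum_list (map w r)" if "awalk x r y" for r
    using conjunct2[OF am] that by (elim allE impE)
  have "graph_dist \<Gamma> w x y = ereal (real (sum_list (map w q)))"
    unfolding graph_dist_def \<mu>_def cost
  proof (rule antisym)
    show "(INF p\<in>{p. awalk x p y}. ereal (real (sum_list (map w p)))) \<le> ereal (real (sum_list (map w q)))"
      by (rule INF_lower) (simp only: mem_Collect_eq q)
    show "ereal (real (sum_list (map w q))) \<le> (INF p\<in>{p. awalk x p y}. ereal (real (sum_list (map w p))))"
      by (rule INF_greatest) (simp only: mem_Collect_eq le ereal_less_eq of_nat_le_iff)
  qed
  with q show ?thesis by (intro exI conjI)
qed

definition fg_submodule ::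
    "('v, 'e) pre_digraph \<Rightarrow> ('l \<Rightarrow> 'v \<Rightarrow> 'v) \<Rightarrow> 'l set \<Rightarrow> 'v set \<Rightarrow> bool" where
  "fg_submodule \<Gamma> \<phi> L' V' \<longleftrightarrow>
     V' \<subseteq> verts \<Gamma> \<and>
     (\<forall>u\<in>L'. \<forall>v\<in>V'. \<phi> u v \<in> V') \<and>
     (\<exists>F. finite F \<and> F \<subseteq> V' \<and> V' = {\<phi> u v | u v. u \<in> L' \<and> v \<in> F})"

definition quasi_polynomial_type :: "(nat \<Rightarrow> complex) \<Rightarrow> bool" where
  "quasi_polynomial_type g \<longleftrightarrow>
     (\<exists>(M::nat) (N::nat) (Q :: nat \<Rightarrow> complex poly). N \<ge> 1 \<and>
        (\<forall>j<N. \<forall>m>M. [m = j] (mod N) \<longrightarrow> g m = poly (Q j) (of_nat m)))"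

end

theory Submission
  imports
    Defs
    "HOL-Library.Function_Algebras"
    "HOL-Library.Multiset_Order"
    "HOL-Library.Product_Plus"
    "HOL-Library.Set_Algebras"
begin

text \<open>
  A walk from \<open>x\<^sub>0\<close> is recorded by its end orbit, its displacement in \<open>\<int>\<^sup>n\<close> and its weight. Since the
  quotient by \<open>L\<close> is a finite graph, Kleene's elimination of states (Parikh's theorem) shows that for
  each end orbit the possible pairs of displacement and weight form a semilinear subset of
  \<open>\<int>\<^sup>n \<times> \<int>\<close>: a finite union of sets \<open>F + gen R\<close> with \<open>F\<close> and \<open>R\<close> finite. By Dickson's lemma the
  sets \<open>F + gen R\<close> are closed under intersections with each other and with cosets of subgroups, so
  \<open>L'\<close> can be brought in and inclusion-exclusion reduces the count to a single \<open>F + gen R\<close>. There a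
  term order picks one exponent for each element, the discarded exponents form an up-closed set, and
  the count becomes a combination of shifts of the numbers of exponents of given weight, which
  satisfy \<open>h (m + d) = h m + g (m + d)\<close> with \<open>g\<close> the count for one generator fewer.
\<close>

section \<open>Functions of quasi-polynomial type\<close>

text \<open>Counting walks, or sums of generators, would overcount: many walks reach one vertex, and
  one label has many exponents. Orbit and position together determine a vertex, so the objects
  counted are distinct labels, and normal forms handle the relations among generators, which are
  arbitrary. Kleene's elimination produces unions whose members overlap without control; closure
  under intersection is therefore needed before anything can be counted. That closure is the reason
  for displacements in a group: after a minimal exponent is subtracted, the remainder must stay in
  the subgroup. Counting is done by exact weight, because a weight is additive on labels while a
  distance is not.\<close>

lemma quasi_polynomial_type_iff:
  "quasi_polynomial_type g \<longleftrightarrow>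
    (\<exists>M N Q. N > 0 \<and> (\<forall>m>M. g m = poly (Q (m mod N)) (of_nat m)))"
proof
  assume "quasi_polynomial_type g"
  then obtain M N Q where "N \<ge> 1"
    and *: "\<And>j m. j < N \<Longrightarrow> m > M \<Longrightarrow> [m = j] (mod N) \<Longrightarrow> g m = poly (Q j) (of_nat m)"
    unfolding quasi_polynomial_type_def by blast
  then have "\<forall>m>M. g m = poly (Q (m mod N)) (of_nat m)"
    by (auto intro!: * simp: cong_def)
  with \<open>N \<ge> 1\<close> show "\<exists>M N Q. N > 0 \<and> (\<forall>m>M. g m = poly (Q (m mod N)) (of_nat m))"
    by (intro exI[of _ M] exI[of _ N] exI[of _ Q]) auto
next
  assume "\<exists>M N Q. N > 0 \<and> (\<forall>m>M. g m = poly (Q (m mod N)) (of_nat m))"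
  then obtain M N Q where "N > 0" "\<forall>m>M. g m = poly (Q (m mod N)) (of_nat m)"
    by blast
  then show "quasi_polynomial_type g"
    unfolding quasi_polynomial_type_def
    by (intro exI[of _ M] exI[of _ N] exI[of _ Q]) (auto simp: cong_def)
qed

lemma quasi_polynomial_type_lincomb:
  assumes "quasi_polynomial_type f" "quasi_polynomial_type g"
  shows "quasi_polynomial_type (\<lambda>m. f m + c * g m)"
proof -
  obtain M1 N1 Q1 where 1: "N1 > 0" "\<And>m. m > M1 \<Longrightarrow> f m = poly (Q1 (m mod N1)) (of_nat m)"
    using assms(1) unfolding quasi_polynomial_type_iff by blast
  obtain M2 N2 Q2 where 2: "N2 > 0" "\<And>m. m > M2 \<Longrightarrow> g m = poly (Q2 (m mod N2)) (of_nat m)"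
    using assms(2) unfolding quasi_polynomial_type_iff by blast
  show ?thesis
    unfolding quasi_polynomial_type_iff
    using 1 2
    by (intro exI[of _ "max M1 M2"] exI[of _ "N1 * N2"]
        exI[of _ "\<lambda>j. Q1 (j mod N1) + smult c (Q2 (j mod N2))"])
      (auto simp: mod_mod_cancel)
qed

lemma quasi_polynomial_type_zero: "quasi_polynomial_type (\<lambda>_. 0)"
  unfolding quasi_polynomial_type_iff
  by (intro exI[of _ 0] exI[of _ 1] exI[of _ "\<lambda>_. 0"]) auto

lemma quasi_polynomial_type_sum:
  assumes "finite A" "\<And>a. a \<in> A \<Longrightarrow> quasi_polynomial_type (f a)"
  shows "quasi_polynomial_type (\<lambda>m. \<Sum>a\<in>A. f a m)"
  using assms
proof (induction A rule: finite_induct)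
  case empty
  then show ?case by (simp add: quasi_polynomial_type_zero)
next
  case (insert a A)
  then show ?case
    using quasi_polynomial_type_lincomb[of "f a" "\<lambda>m. \<Sum>a\<in>A. f a m" 1] by simp
qed

lemma quasi_polynomial_type_eventually_eq:
  assumes "quasi_polynomial_type f" "\<And>m. m > K \<Longrightarrow> g m = f m"
  shows "quasi_polynomial_type g"
proof -
  obtain M N Q where "N > 0" "\<And>m. m > M \<Longrightarrow> f m = poly (Q (m mod N)) (of_nat m)"
    using assms(1) unfolding quasi_polynomial_type_iff by blast
  with assms(2) show ?thesis
    unfolding quasi_polynomial_type_iff
    by (intro exI[of _ "max M K"] exI[of _ N] exI[of _ Q]) auto
qed

lemma quasi_polynomial_type_shift:
  assumes "quasi_polynomial_type f"
  shows "quasi_polynomial_type (\<lambda>m. if c \<le> m then f (m - c) else 0)"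
proof -
  obtain M N Q where N: "N > 0" and f: "\<And>m. m > M \<Longrightarrow> f m = poly (Q (m mod N)) (of_nat m)"
    using assms unfolding quasi_polynomial_type_iff by blast
  \<comment> \<open>The multiple \<open>(N - 1) * c\<close> represents \<open>- c\<close> modulo
    \<open>N\<close> without truncated subtraction; the composition replaces the argument
    \<open>m\<close> by \<open>m - c\<close>.\<close>
  define R where "R j = pcompose (Q ((j + (N - 1) * c) mod N)) [:- of_nat c, 1:]" for j
  have "(if c \<le> m then f (m - c) else 0) = poly (R (m mod N)) (of_nat m)" if "m > M + c" for m
  proof -
    have "(m mod N + (N - 1) * c) mod N = (m + (N - 1) * c) mod N"
      by (simp add: mod_add_left_eq)
    also have "m + (N - 1) * c = (m - c) + N * c"
      using that N by (cases N) auto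
    also have "(\<dots>) mod N = (m - c) mod N" by simp
    finally show ?thesis
      using that f[of "m - c"] by (simp add: R_def poly_pcompose of_nat_diff)
  qed
  with N show ?thesis
    unfolding quasi_polynomial_type_iff
    by (intro exI[of _ "M + c"] exI[of _ N] exI[of _ R]) simp
qed

text \<open>Over a step \<open>c\<close> the difference of \<open>x ^ Suc n\<close> has degree
  \<open>n\<close> and leading coefficient \<open>Suc n * c\<close>, which is nonzero in
  characteristic zero. A multiple of it removes the coefficient of \<open>P\<close> at
  \<open>n\<close>, and the rest follows by induction.\<close>

lemma poly_difference_equation:
  fixes P :: "'a::field_char_0 poly"
  assumes "c \<noteq> 0"
  shows "\<exists>S. \<forall>x. poly S (x + c) - poly S x = poly P x"
proof -
  \<comment> \<open>Bounding the support of the coefficients instead of the degree makes the zero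
    polynomial the base case.\<close>
  have "\<exists>S. \<forall>x. poly S (x + c) - poly S x = poly P x"
    if "\<forall>i\<ge>n. coeff P i = 0" for n and P :: "'a poly"
    using that
  proof (induction n arbitrary: P)
    case 0
    then have "P = 0" by (simp add: poly_eq_iff)
    then show ?case by (intro exI[of _ 0]) simp
  next
    case (Suc n)
    define t where "t = coeff P n / (of_nat (Suc n) * c)"
    define T where "T = smult t ([:c, 1:] ^ Suc n - [:0, 1:] ^ Suc n)"
    have big: "coeff ([:a, 1:] ^ Suc n) i = 0" if "i > Suc n" for i and a :: 'a
      using that by (intro coeff_eq_0) (simp only: degree_linear_power)
    have coeffT: "coeff T i = t * (of_nat (Suc n choose i) * c ^ (Suc n - i) - (if i = Suc n then 1 else 0))"
      for i
      unfolding T_def coeff_smult coeff_diff coeff_linear_poly_power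
      by (cases "i < Suc n"; cases "i = Suc n")
        (auto simp: power_0_left coeff_linear_poly_power binomial_eq_0 big simp del: power_Suc)
    have "coeff (P - T) i = 0" if le: "i \<ge> n" for i
    proof -
      consider "i = n" | "i = Suc n" | "i > Suc n" using le by linarith
      then show ?thesis
      proof cases
        case 1
        have "of_nat (Suc n) * c \<noteq> 0" using assms by (simp del: of_nat_Suc)
        then show ?thesis using 1 by (simp add: coeffT t_def del: of_nat_Suc)
      qed (use Suc.prems in \<open>auto simp: coeffT\<close>)
    qed
    then obtain S where S: "\<And>x. poly S (x + c) - poly S x = poly (P - T) x"
      using Suc.IH[of "P - T"] by blast
    have "poly (S + smult t ([:0, 1:] ^ Suc n)) (x + c) - poly (S + smult t ([:0, 1:] ^ Suc n)) x
        = poly P x" for x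
      using S[of x] by (simp add: T_def poly_power algebra_simps del: power_Suc)
    then show ?case by blast
  qed
  then show ?thesis
    using coeff_eq_0[of P] by (metis Suc_le_eq)
qed

text \<open>One step of size \<open>d\<close> may change the residue modulo \<open>N\<close>, but
  \<open>N\<close> steps do not. Over the step \<open>K = N * d\<close> the increment of
  \<open>h\<close> is a single polynomial on each class modulo \<open>K\<close>; a polynomial with
  the same increment differs from \<open>h\<close> by a constant on each class.\<close>

lemma quasi_polynomial_type_recurrence:
  assumes g: "quasi_polynomial_type g" and d: "d > 0"
    and h: "\<And>m. h (m + d) = h m + g (m + d)"
  shows "quasi_polynomial_type h"
proof -
  obtain M N Q where N: "N > 0" and gQ: "\<And>m. m > M \<Longrightarrow> g m = poly (Q (m mod N)) (of_nat m)"
    using g unfolding quasi_polynomial_type_iff by blast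
  define K where "K = N * d"
  have K: "K > 0" using N d by (simp add: K_def)
  have step: "h (m + k * d) = h m + (\<Sum>i<k. g (m + Suc i * d))" for m k
  proof (induction k)
    case (Suc k)
    then show ?case using h[of "m + k * d"] by (simp add: algebra_simps)
  qed simp
  \<comment> \<open>\<open>P j\<close> is the sum of \<open>g\<close> at \<open>m + d\<close>, ...,
    \<open>m + N * d\<close>, written as a polynomial in \<open>m\<close> for \<open>m\<close> in
    the class \<open>j\<close> modulo \<open>K\<close>.\<close>
  define P where "P j = (\<Sum>i<N. pcompose (Q ((j + Suc i * d) mod N)) [:of_nat (Suc i * d), 1:])" for j
  have hP: "h (m + K) = h m + poly (P (m mod K)) (of_nat m)" if "m > M" for m
  proof -
    have "(m mod K + x) mod N = (m + x) mod N" for x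
      by (metis K_def dvd_triv_left mod_add_left_eq mod_mod_cancel)
    then have "Q ((m mod K + Suc i * d) mod N) = Q ((m + Suc i * d) mod N)" for i
      by metis
    then have "poly (P (m mod K)) (of_nat m) = (\<Sum>i<N. g (m + Suc i * d))"
      using that by (simp add: P_def poly_sum poly_pcompose gQ add_ac del: mult_Suc)
    with step[of m N] show ?thesis by (simp add: K_def)
  qed
  have "\<exists>S. \<forall>x. poly S (x + of_nat K) - poly S x = poly (P j) x" for j
    using K by (intro poly_difference_equation) simp
  then obtain S where S: "\<And>j x. poly (S j) (x + of_nat K) - poly (S j) x = poly (P j) x"
    by metis
  \<comment> \<open>A base point of the class \<open>j\<close> beyond \<open>M\<close>, from which
    the recurrence for \<open>h\<close> is available.\<close>
  define b where "b j = Suc M * K + j" for j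
  define D where "D j = h (b j) - poly (S j) (of_nat (b j))" for j
  have const: "h (b j + n * K) - poly (S j) (of_nat (b j + n * K)) = D j" if "j < K" for j n
  proof (induction n)
    case (Suc n)
    let ?m = "b j + n * K"
    have "?m = j + (Suc M + n) * K" by (simp add: b_def algebra_simps)
    then have "?m mod K = j" using that by (metis mod_mult_self1 mod_less)
    moreover have "?m > M"
      using K by (cases K) (auto simp: b_def)
    ultimately have "h (?m + K) = h ?m + poly (P j) (of_nat ?m)" using hP by metis
    with Suc S[of j "of_nat ?m"] show ?case by (simp add: algebra_simps)
  qed (simp add: D_def)
  have "h m = poly (S (m mod K) + [:D (m mod K):]) (of_nat m)" if "m > Suc M * K + K" for m
  proof -
    have "Suc M \<le> m div K"
      using that K by (simp add: less_eq_div_iff_mult_less_eq)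
    then obtain n where "m div K = Suc M + n" using le_Suc_ex by blast
    then have "b (m mod K) + n * K = m"
      using div_mult_mod_eq[of m K] by (simp add: b_def algebra_simps)
    then have "h m - poly (S (m mod K)) (of_nat m) = D (m mod K)"
      using const[of "m mod K" n] K by (simp only: mod_less_divisor)
    then show ?thesis by (simp add: diff_eq_eq add.commute)
  qed
  with K show ?thesis
    unfolding quasi_polynomial_type_iff
    by (intro exI[of _ "Suc M * K + K"] exI[of _ K] exI[of _ "\<lambda>j. S j + [:D j:]"]) simp
qed

section \<open>Finitely generated modules over submonoids of abelian groups\<close>

text \<open>Multisets over \<open>I\<close> are exponent vectors, and \<open>\<subseteq>#\<close> is
  the componentwise order. One coordinate \<open>a\<close> is split off: a finite basis for the
  remaining coordinates dominates every vector whose entry at \<open>a\<close> is large, and each of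
  the finitely many small entries has a basis of its own.\<close>

lemma dickson_multiset:
  assumes "finite I" "\<And>M. M \<in> X \<Longrightarrow> set_mset M \<subseteq> I"
  shows "\<exists>B\<subseteq>X. finite B \<and> (\<forall>M\<in>X. \<exists>N\<in>B. N \<subseteq># M)"
  using assms
proof (induction I arbitrary: X rule: finite_induct)
  case empty
  then have "X \<subseteq> {{#}}" by auto
  then show ?case by (intro exI[of _ X]) (auto intro: finite_subset)
next
  case (insert a I)
  define p where "p M = filter_mset (\<lambda>x. x \<noteq> a) M" for M :: "'a multiset"
  have sub: "N \<subseteq># M" if "p N \<subseteq># p M" "count N a \<le> count M a" for M N
  proof (rule mset_subset_eqI)
    fix x show "count N x \<le> count M x"
      using mset_subset_eq_count[OF that(1), of x] that(2) by (cases "x = a") (auto simp: p_def)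
  qed
  have basis: "\<exists>B\<subseteq>Y. finite B \<and> (\<forall>M\<in>Y. \<exists>N\<in>B. p N \<subseteq># p M)" if "Y \<subseteq> X" for Y
  proof -
    have "set_mset M \<subseteq> I" if "M \<in> p ` Y" for M
      using that insert.prems \<open>Y \<subseteq> X\<close> by (fastforce simp: p_def)
    then have "\<exists>B0\<subseteq>p ` Y. finite B0 \<and> (\<forall>M\<in>p ` Y. \<exists>N\<in>B0. N \<subseteq># M)"
      by (rule insert.IH)
    then obtain B0 where "B0 \<subseteq> p ` Y" "finite B0" and B0: "\<forall>M\<in>p ` Y. \<exists>N\<in>B0. N \<subseteq># M"
      by (elim exE conjE)
    then obtain B where "B \<subseteq> Y" "finite B" "B0 = p ` B"
      by (metis finite_subset_image)
    with B0 show ?thesis by (intro exI[of _ B]) auto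
  qed
  obtain B where B: "B \<subseteq> X" "finite B" "\<And>M. M \<in> X \<Longrightarrow> \<exists>N\<in>B. p N \<subseteq># p M"
    using basis[of X] by blast
  \<comment> \<open>Beyond \<open>k\<close> the entry at \<open>a\<close> no longer obstructs
    domination by a member of \<open>B\<close>.\<close>
  obtain k where k: "\<And>N. N \<in> B \<Longrightarrow> count N a \<le> k"
    using finite_nat_set_iff_bounded_le[of "(\<lambda>N. count N a) ` B"] B(2) by auto
  have "\<forall>i. \<exists>B'. B' \<subseteq> {M \<in> X. count M a = i} \<and> finite B' \<and>
      (\<forall>M\<in>{M \<in> X. count M a = i}. \<exists>N\<in>B'. p N \<subseteq># p M)"
    by (intro allI basis) auto
  from choice[OF this] obtain B' where "\<forall>i. B' i \<subseteq> {M \<in> X. count M a = i} \<and> finite (B' i) \<and>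
      (\<forall>M\<in>{M \<in> X. count M a = i}. \<exists>N\<in>B' i. p N \<subseteq># p M)"
    by (rule exE)
  then have B': "\<And>i. B' i \<subseteq> {M \<in> X. count M a = i}" "\<And>i. finite (B' i)"
    "\<And>i. \<forall>M\<in>{M \<in> X. count M a = i}. \<exists>N\<in>B' i. p N \<subseteq># p M"
    by simp_all
  have "\<exists>N\<in>B \<union> (\<Union>i\<le>k. B' i). N \<subseteq># M" if MX: "M \<in> X" for M
  proof (cases "count M a \<le> k")
    case True
    obtain N where "N \<in> B' (count M a)" "p N \<subseteq># p M" using B'(3)[of "count M a"] MX by blast
    then have "count N a = count M a" using B'(1)[of "count M a"] by blast
    then have "N \<subseteq># M" using \<open>p N \<subseteq># p M\<close> by (simp add: sub)
    moreover have "N \<in> (\<Union>i\<le>k. B' i)"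
      using True \<open>N \<in> B' (count M a)\<close> by auto
    ultimately show ?thesis by (rule bexI[OF _ UnI2])
  next
    case False
    obtain N where "N \<in> B" "p N \<subseteq># p M" using B(3)[OF MX] by blast
    then have "N \<subseteq># M" using False k[of N] by (simp add: sub)
    then show ?thesis using \<open>N \<in> B\<close> by (rule bexI[OF _ UnI1])
  qed
  moreover have "B \<union> (\<Union>i\<le>k. B' i) \<subseteq> X" using B(1) B'(1) by blast
  moreover have "finite (B \<union> (\<Union>i\<le>k. B' i))" using B(2) B'(2) by simp
  ultimately show ?case by (intro exI[of _ "B \<union> (\<Union>i\<le>k. B' i)"] conjI ballI)
qed

section \<open>Submonoids generated by a set\<close>

inductive_set gen :: "'a::comm_monoid_add set \<Rightarrow> 'a set" for R where
  zero: "0 \<in> gen R"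
| add: "r \<in> R \<Longrightarrow> x \<in> gen R \<Longrightarrow> r + x \<in> gen R"

definition add_submonoid :: "'a::comm_monoid_add set \<Rightarrow> bool" where
  "add_submonoid C \<longleftrightarrow> 0 \<in> C \<and> (\<forall>x\<in>C. \<forall>y\<in>C. x + y \<in> C)"

definition add_subgroup :: "'a::ab_group_add set \<Rightarrow> bool" where
  "add_subgroup H \<longleftrightarrow> 0 \<in> H \<and> (\<forall>x\<in>H. \<forall>y\<in>H. x - y \<in> H)"

lemma gen_base: "r \<in> R \<Longrightarrow> r \<in> gen R"
  using gen.add[OF _ gen.zero] by force

lemma gen_plus_closed: "x \<in> gen R \<Longrightarrow> y \<in> gen R \<Longrightarrow> x + y \<in> gen R"
  by (induction rule: gen.induct) (auto simp: add.assoc intro: gen.add)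

lemma add_submonoid_gen: "add_submonoid (gen R)"
  by (auto simp: add_submonoid_def intro: gen.zero gen_plus_closed)

lemma gen_least: "add_submonoid C \<Longrightarrow> R \<subseteq> C \<Longrightarrow> gen R \<subseteq> C"
proof
  fix x assume C: "add_submonoid C" "R \<subseteq> C" and "x \<in> gen R"
  from this(3) show "x \<in> C"
    by (induction rule: gen.induct) (use C in \<open>auto simp: add_submonoid_def\<close>)
qed

lemma gen_mono: "R \<subseteq> S \<Longrightarrow> gen R \<subseteq> gen S"
  by (meson add_submonoid_gen gen_base gen_least subset_iff)

lemma gen_empty: "gen {} = {0}"
  using gen_least[of "{0}" "{}"] gen.zero by (auto simp: add_submonoid_def)

lemma gen_Un: "gen (R \<union> S) = gen R + gen S"
proof
  have "add_submonoid (gen R + gen S)"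
    unfolding add_submonoid_def
  proof (intro conjI ballI)
    show "0 \<in> gen R + gen S" using set_plus_intro[OF gen.zero gen.zero] by simp
    fix x y assume "x \<in> gen R + gen S" "y \<in> gen R + gen S"
    then obtain a b c d where "x = a + b" "y = c + d" "a \<in> gen R" "b \<in> gen S" "c \<in> gen R" "d \<in> gen S"
      by (auto elim!: set_plus_elim)
    moreover have "a + b + (c + d) = (a + c) + (b + d)" by (simp add: add_ac)
    ultimately show "x + y \<in> gen R + gen S"
      by (auto intro: gen_plus_closed)
  qed
  moreover have "R \<subseteq> gen R + gen S"
    using set_plus_intro[OF gen_base gen.zero] by fastforce
  moreover have "S \<subseteq> gen R + gen S"
    using set_plus_intro[OF gen.zero gen_base] by fastforce
  ultimately show "gen (R \<union> S) \<subseteq> gen R + gen S"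
    by (intro gen_least) auto
next
  show "gen R + gen S \<subseteq> gen (R \<union> S)"
    using gen_mono[of R "R \<union> S"] gen_mono[of S "R \<union> S"]
    by (auto elim!: set_plus_elim intro!: gen_plus_closed)
qed

text \<open>Presents the generated monoid as an image of the free commutative monoid on
  \<open>I\<close>. The index map \<open>r\<close> permits natural numbers as names of generators,
  so that exponents can be well-ordered whatever the type of the labels.\<close>

lemma gen_eq_sum_mset: "gen (r ` I) = {\<Sum>i\<in>#M. r i | M. set_mset M \<subseteq> I}"
proof (intro equalityI subsetI)
  fix x assume "x \<in> gen (r ` I)"
  then show "x \<in> {\<Sum>i\<in>#M. r i | M. set_mset M \<subseteq> I}"
  proof (induction rule: gen.induct)
    case zero
    show ?case by (auto intro!: exI[of _ "{#}"])
  next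
    case (add s x)
    then obtain i M where "s = r i" "i \<in> I" "x = (\<Sum>i\<in>#M. r i)" "set_mset M \<subseteq> I" by auto
    then show ?case by (auto intro!: exI[of _ "add_mset i M"])
  qed
next
  have "set_mset M \<subseteq> I \<Longrightarrow> (\<Sum>i\<in>#M. r i) \<in> gen (r ` I)" for M
    by (induction M) (auto intro: gen.intros)
  then show "x \<in> gen (r ` I)" if "x \<in> {\<Sum>i\<in>#M. r i | M. set_mset M \<subseteq> I}" for x
    using that by auto
qed

lemma gen_image:
  assumes "h 0 = 0" "\<And>x y. h (x + y) = h x + h y"
  shows "h ` gen R = gen (h ` R)"
proof (intro equalityI subsetI)
  fix y assume "y \<in> h ` gen R"
  then obtain x where "x \<in> gen R" "y = h x" by blast
  then show "y \<in> gen (h ` R)"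
    by (induction arbitrary: y rule: gen.induct) (auto simp: assms intro: gen.intros)
next
  fix y assume "y \<in> gen (h ` R)"
  then show "y \<in> h ` gen R"
  proof (induction rule: gen.induct)
    case zero
    show ?case using gen.zero assms(1) by force
  next
    case (add s x)
    then obtain a b where "s = h a" "a \<in> R" "x = h b" "b \<in> gen R" by blast
    then show ?case using gen.add[of a R b] assms(2) by (metis imageI)
  qed
qed

text \<open>
  The ambient submonoid \<open>C\<close> is later the set of labels that are zero or of positive weight, which is
  what makes the graded pieces finite.
\<close>

definition fg_module :: "'a::comm_monoid_add set \<Rightarrow> 'a set \<Rightarrow> bool" where
  "fg_module C X \<longleftrightarrow>
    (\<exists>F R. finite F \<and> finite R \<and> F \<subseteq> C \<and> R \<subseteq> C \<and> X = F + gen R)"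

lemma fg_moduleI:
  "finite F \<Longrightarrow> finite R \<Longrightarrow> F \<subseteq> C \<Longrightarrow> R \<subseteq> C \<Longrightarrow> fg_module C (F + gen R)"
  unfolding fg_module_def by blast

lemma fg_module_subset:
  assumes "add_submonoid C" "fg_module C X"
  shows "X \<subseteq> C"
proof -
  obtain F R where X: "F \<subseteq> C" "R \<subseteq> C" "X = F + gen R"
    using assms(2) unfolding fg_module_def by blast
  have "gen R \<subseteq> C" using assms(1) X(2) by (rule gen_least)
  then show ?thesis
    using X(1) assms(1) unfolding X(3) add_submonoid_def by (blast elim!: set_plus_elim)
qed

lemma fg_module_image:
  assumes "fg_module C X" "h 0 = 0" "\<And>x y. h (x + y) = h x + h y" "h ` C \<subseteq> D"
  shows "fg_module D (h ` X)"
proof -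
  obtain F R where X: "finite F" "finite R" "F \<subseteq> C" "R \<subseteq> C" "X = F + gen R"
    using assms(1) unfolding fg_module_def by blast
  have "h ` X = h ` F + h ` gen R"
  proof (intro equalityI subsetI)
    fix y assume "y \<in> h ` F + h ` gen R"
    then obtain a b where "a \<in> F" "b \<in> gen R" "y = h (a + b)"
      by (auto elim!: set_plus_elim simp: assms(3))
    then show "y \<in> h ` X" unfolding X(5) by blast
  qed (auto simp: X(5) assms(3) elim!: set_plus_elim intro!: set_plus_intro)
  also have "h ` gen R = gen (h ` R)"
    by (intro gen_image assms)
  finally have "h ` X = h ` F + gen (h ` R)" .
  moreover have "h ` F \<subseteq> D" "h ` R \<subseteq> D" using X(3,4) assms(4) by blast+
  ultimately show ?thesis
    using X(1,2) by (simp add: fg_moduleI)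
qed

lemma fg_module_plus:
  assumes "add_submonoid C" "fg_module C X" "fg_module C Y"
  shows "fg_module C (X + Y)"
proof -
  obtain F R where X: "finite F" "finite R" "F \<subseteq> C" "R \<subseteq> C" "X = F + gen R"
    using assms(2) unfolding fg_module_def by blast
  obtain E Q where Y: "finite E" "finite Q" "E \<subseteq> C" "Q \<subseteq> C" "Y = E + gen Q"
    using assms(3) unfolding fg_module_def by blast
  have "X + Y = (F + E) + gen (R \<union> Q)"
    unfolding X Y gen_Un by (simp add: add_ac)
  moreover have "F + E \<subseteq> C"
    using X(3) Y(3) assms(1) by (fastforce simp: add_submonoid_def set_plus_def)
  ultimately show ?thesis
    using X Y by (auto intro!: fg_moduleI finite_set_plus)
qed

lemma fg_module_finite:
  assumes "finite X" "X \<subseteq> C"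
  shows "fg_module C X"
  using fg_moduleI[of X "{}" C] assms by (simp add: gen_empty)

text \<open>
  By Dickson's lemma the minimal nonzero exponents of elements of \<open>gen R \<inter> H\<close> generate it, since
  \<open>H\<close> is closed under differences; the same applies to the exponents of elements of the coset.
\<close>

lemma gen_Int_subgroup:
  fixes R :: "'a::ab_group_add set"
  assumes "finite R" "add_subgroup H"
  shows "\<exists>S. finite S \<and> S \<subseteq> gen R \<and> gen R \<inter> H = gen S"
proof -
  define K where "K = {M. set_mset M \<subseteq> R \<and> \<Sum>\<^sub># M \<in> H}"
  have Hadd: "x + y \<in> H" if "x \<in> H" "y \<in> H" for x y
  proof -
    have "0 - y \<in> H" using assms(2) that unfolding add_subgroup_def by blast
    then have "x - (0 - y) \<in> H" using assms(2) that unfolding add_subgroup_def by blast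
    then show ?thesis by simp
  qed
  have genR: "gen R = {\<Sum>\<^sub># M | M. set_mset M \<subseteq> R}"
    using gen_eq_sum_mset[of "\<lambda>x. x" R] by simp
  \<comment> \<open>Without the removal of \<open>{#}\<close> the basis could be
    \<open>{{#}}\<close> alone; nonempty members of \<open>B\<close> make the remainder
    \<open>M - N\<close> strictly smaller.\<close>
  have "\<exists>B\<subseteq>K - {{#}}. finite B \<and> (\<forall>M\<in>K - {{#}}. \<exists>N\<in>B. N \<subseteq># M)"
    using assms(1) by (rule dickson_multiset) (simp add: K_def)
  then obtain B where B: "B \<subseteq> K - {{#}}" "finite B" "\<forall>M\<in>K - {{#}}. \<exists>N\<in>B. N \<subseteq># M"
    by (elim exE conjE)
  have "\<Sum>\<^sub># M \<in> gen (sum_mset ` B)" if "M \<in> K" for M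
    using that
  proof (induction M rule: measure_induct_rule[of size])
    case (less M)
    show ?case
    proof (cases "M = {#}")
      case True
      then show ?thesis by (simp add: gen.zero)
    next
      case False
      then obtain N where N: "N \<in> B" "N \<subseteq># M" using bspec[OF B(3), of M] less.prems by blast
      have M: "M = N + (M - N)" using N(2) by simp
      then have sum: "\<Sum>\<^sub># M = \<Sum>\<^sub># N + \<Sum>\<^sub># (M - N)" by (metis sum_mset.union)
      have "\<Sum>\<^sub># (M - N) \<in> H"
        using assms(2) less.prems N(1) B(1) sum unfolding add_subgroup_def K_def
        by (metis (mono_tags, lifting) DiffD1 add_diff_cancel_left' mem_Collect_eq subsetD)
      then have "M - N \<in> K"
        using less.prems by (auto simp: K_def dest: in_diffD)
      moreover have "N \<noteq> {#}" using N(1) B(1) by auto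
      then have "size (M - N) < size M"
        using M by (metis less_add_same_cancel2 nonempty_has_size size_union)
      ultimately show ?thesis
        using less.IH N(1) sum by (auto intro: gen.add)
    qed
  qed
  then have "gen R \<inter> H \<subseteq> gen (sum_mset ` B)"
    by (auto simp: genR K_def)
  moreover have "sum_mset ` B \<subseteq> gen R" using B(1) by (auto simp: genR K_def)
  moreover have "gen (sum_mset ` B) \<subseteq> gen R \<inter> H"
  proof (rule gen_least)
    show "add_submonoid (gen R \<inter> H)"
      using add_submonoid_gen[of R] assms(2) Hadd by (auto simp: add_submonoid_def add_subgroup_def)
    show "sum_mset ` B \<subseteq> gen R \<inter> H" using B(1) by (auto simp: genR K_def)
  qed
  ultimately show ?thesis using B(2) by (intro exI[of _ "sum_mset ` B"]) auto
qed

lemma gen_Int_coset: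
  fixes R :: "'a::ab_group_add set"
  assumes "finite R" "add_subgroup H"
  shows "\<exists>E. finite E \<and> E \<subseteq> gen R \<and> {x \<in> gen R. x - c \<in> H} = E + (gen R \<inter> H)"
proof -
  define T where "T = {M. set_mset M \<subseteq> R \<and> \<Sum>\<^sub># M - c \<in> H}"
  have genR: "gen R = {\<Sum>\<^sub># M | M. set_mset M \<subseteq> R}"
    using gen_eq_sum_mset[of "\<lambda>x. x" R] by simp
  have "\<exists>B\<subseteq>T. finite B \<and> (\<forall>M\<in>T. \<exists>N\<in>B. N \<subseteq># M)"
    using assms(1) by (rule dickson_multiset) (simp add: T_def)
  then obtain B where B: "B \<subseteq> T" "finite B" "\<forall>M\<in>T. \<exists>N\<in>B. N \<subseteq># M"
    by (elim exE conjE)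
  have Hdiff: "x - y \<in> H" if "x \<in> H" "y \<in> H" for x y
    using assms(2) that unfolding add_subgroup_def by blast
  have Hadd: "x + y \<in> H" if "x \<in> H" "y \<in> H" for x y
    using Hdiff[of 0 y] Hdiff[of x "- y"] that assms(2) by (simp add: add_subgroup_def)
  have "\<Sum>\<^sub># M \<in> sum_mset ` B + (gen R \<inter> H)" if M: "M \<in> T" for M
  proof -
    obtain N where N: "N \<in> B" "N \<subseteq># M" using bspec[OF B(3) M] by blast
    then have sum: "\<Sum>\<^sub># M = \<Sum>\<^sub># N + \<Sum>\<^sub># (M - N)"
      by (metis subset_mset.add_diff_inverse sum_mset.union)
    \<comment> \<open>Both sums lie in the coset of \<open>c\<close>, so the remainder is a
      difference of two elements of \<open>H\<close>.\<close>
    have "\<Sum>\<^sub># (M - N) = (\<Sum>\<^sub># M - c) - (\<Sum>\<^sub># N - c)" using sum by simp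
    moreover have "\<Sum>\<^sub># M - c \<in> H" "\<Sum>\<^sub># N - c \<in> H" using M N(1) B(1) by (auto simp: T_def)
    ultimately have "\<Sum>\<^sub># (M - N) \<in> H" by (simp only: Hdiff)
    moreover have "\<Sum>\<^sub># (M - N) \<in> gen R"
      using M by (auto simp: genR T_def dest: in_diffD)
    ultimately show ?thesis unfolding sum using N(1) by blast
  qed
  then have "{x \<in> gen R. x - c \<in> H} \<subseteq> sum_mset ` B + (gen R \<inter> H)"
    by (auto simp: genR T_def)
  moreover have "sum_mset ` B \<subseteq> gen R" using B(1) by (auto simp: genR T_def)
  moreover have "sum_mset ` B + (gen R \<inter> H) \<subseteq> {x \<in> gen R. x - c \<in> H}"
  proof
    fix x assume "x \<in> sum_mset ` B + (gen R \<inter> H)"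
    then obtain N y where x: "x = \<Sum>\<^sub># N + y" "N \<in> B" "y \<in> gen R" "y \<in> H"
      by (auto elim!: set_plus_elim)
    then have "\<Sum>\<^sub># N - c \<in> H" "\<Sum>\<^sub># N \<in> gen R" using B(1) by (auto simp: genR T_def)
    with Hadd[OF this(1) x(4)] gen_plus_closed[OF this(2) x(3)] show "x \<in> {x \<in> gen R. x - c \<in> H}"
      unfolding x(1) by (simp add: algebra_simps)
  qed
  ultimately show ?thesis using B(2) by (intro exI[of _ "sum_mset ` B"]) auto
qed

text \<open>On the translate by \<open>f\<close> the condition becomes membership in the coset of
  \<open>c - f\<close> inside \<open>gen R\<close>. All these cosets are modules over the same
  monoid \<open>gen R \<inter> H\<close>, so a single \<open>S\<close> serves every \<open>f\<close>
  and only the base points differ.\<close>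

lemma fg_module_Int_coset:
  fixes X :: "'a::ab_group_add set"
  assumes "add_submonoid C" "fg_module C X" "add_subgroup H"
  shows "fg_module C {x \<in> X. x - c \<in> H}"
proof -
  obtain F R where X: "finite F" "finite R" "F \<subseteq> C" "R \<subseteq> C" "X = F + gen R"
    using assms(2) unfolding fg_module_def by blast
  obtain S where S: "finite S" "S \<subseteq> gen R" "gen R \<inter> H = gen S"
    using gen_Int_subgroup[OF X(2) assms(3)] by blast
  obtain E where E: "\<And>f. finite (E f)" "\<And>f. E f \<subseteq> gen R"
    "\<And>f. {x \<in> gen R. x - (c - f) \<in> H} = E f + gen S"
    using gen_Int_coset[OF X(2) assms(3)] unfolding S(3) by metis
  have C: "gen R \<subseteq> C" using assms(1) X(4) by (rule gen_least)
  define G where "G = (\<Union>f\<in>F. (+) f ` E f)"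
  have "f + r \<in> G + gen S" if "f \<in> F" "r \<in> gen R" "f + r - c \<in> H" for f r
  proof -
    have "r - (c - f) \<in> H" using that(3) by (simp add: algebra_simps)
    then have "r \<in> E f + gen S" using that(2) unfolding E(3)[symmetric] by simp
    then obtain e s where "e \<in> E f" "s \<in> gen S" "r = e + s" by (auto elim!: set_plus_elim)
    with that(1) show ?thesis
      by (auto simp: G_def add.assoc[symmetric] intro!: set_plus_intro)
  qed
  moreover have "f + e + s \<in> {x \<in> X. x - c \<in> H}" if "f \<in> F" "e \<in> E f" "s \<in> gen S" for f e s
  proof -
    have "e + s \<in> {x \<in> gen R. x - (c - f) \<in> H}" using that E(3) by blast
    then have "f + (e + s) \<in> X" "f + (e + s) - c \<in> H"
      using that(1) X(5) by (auto simp: diff_diff_eq2 add.commute)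
    then show ?thesis by (simp add: add.assoc)
  qed
  ultimately have "{x \<in> X. x - c \<in> H} = G + gen S"
    unfolding X(5) by (auto elim!: set_plus_elim simp: G_def)
  moreover have "finite G" using X(1) E(1) by (auto simp: G_def)
  moreover have "G \<subseteq> C"
    using X(3) E(2) C assms(1) unfolding G_def add_submonoid_def by blast
  moreover have "S \<subseteq> C" using S(2) C by blast
  ultimately show ?thesis using S(1) by (simp add: fg_moduleI)
qed

text \<open>The generators are placed on the two axes, since \<open>R \<times> S\<close> would in
  general generate less: \<open>{1} \<times> {1}\<close> yields only a diagonal.\<close>

lemma gen_Times:
  fixes R :: "'a::comm_monoid_add set" and S :: "'b::comm_monoid_add set"
  shows "gen (R \<times> {0} \<union> {0} \<times> S) = gen R \<times> gen S"
proof -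
  have "(\<lambda>x. (x, 0::'b)) ` gen R = gen ((\<lambda>x. (x, 0)) ` R)"
    by (rule gen_image) (simp_all add: zero_prod_def)
  moreover have "Pair (0::'a) ` gen S = gen (Pair 0 ` S)"
    by (rule gen_image) (simp_all add: zero_prod_def)
  moreover have "(\<lambda>x. (x, 0::'b)) ` R = R \<times> {0}" "Pair (0::'a) ` S = {0} \<times> S" by auto
  ultimately have "gen (R \<times> {0} \<union> {0} \<times> S) = (\<lambda>x. (x, 0)) ` gen R + Pair 0 ` gen S"
    by (simp only: gen_Un)
  also have "\<dots> = gen R \<times> gen S" by (auto simp: set_plus_def)
  finally show ?thesis .
qed

text \<open>\<open>X \<inter> Y\<close> is a projection of \<open>X \<times> Y\<close> cut by the diagonal subgroup.\<close>

lemma fg_module_Int: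
  fixes X Y :: "'a::ab_group_add set"
  assumes "add_submonoid C" "fg_module C X" "fg_module C Y"
  shows "fg_module C (X \<inter> Y)"
proof -
  obtain F R where X: "finite F" "finite R" "F \<subseteq> C" "R \<subseteq> C" "X = F + gen R"
    using assms(2) unfolding fg_module_def by blast
  obtain E Q where Y: "finite E" "finite Q" "E \<subseteq> C" "Q \<subseteq> C" "Y = E + gen Q"
    using assms(3) unfolding fg_module_def by blast
  have C0: "0 \<in> C" using assms(1) by (simp add: add_submonoid_def)
  have CC: "add_submonoid (C \<times> C)"
    using assms(1) by (auto simp: add_submonoid_def zero_prod_def)
  have "X \<times> Y = F \<times> E + gen (R \<times> {0} \<union> {0} \<times> Q)"
    unfolding gen_Times X(5) Y(5) by (force simp: set_plus_def)
  then have "fg_module (C \<times> C) (X \<times> Y)"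
    using X Y C0 by (auto intro!: fg_moduleI)
  moreover have "add_subgroup (range (\<lambda>x::'a. (x, x)))"
    by (auto simp: add_subgroup_def zero_prod_def)
  \<comment> \<open>The subgroup is its own coset through \<open>0\<close>, whence the shape
    \<open>z - 0\<close>.\<close>
  ultimately have "fg_module (C \<times> C) {z \<in> X \<times> Y. z - 0 \<in> range (\<lambda>x. (x, x))}"
    using CC by (intro fg_module_Int_coset)
  then have "fg_module C (fst ` {z \<in> X \<times> Y. z - 0 \<in> range (\<lambda>x. (x, x))})"
    by (rule fg_module_image) auto
  also have "fst ` {z \<in> X \<times> Y. z - 0 \<in> range (\<lambda>x. (x, x))} = X \<inter> Y"
    by (force simp: image_iff)
  finally show ?thesis .
qed

section \<open>Counting by degree\<close>

text \<open>Finiteness belongs to the notion because \<open>card\<close> is \<open>0\<close> on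
  infinite sets, which would invalidate the counting identities for unions and differences.\<close>

definition quasi_polynomial_graded :: "('a \<Rightarrow> nat) \<Rightarrow> 'a set \<Rightarrow> bool" where
  "quasi_polynomial_graded deg X \<longleftrightarrow>
    (\<forall>i. finite {x \<in> X. deg x = i}) \<and>
    quasi_polynomial_type (\<lambda>i. of_nat (card {x \<in> X. deg x = i}))"

lemma quasi_polynomial_graded_empty: "quasi_polynomial_graded deg {}"
  by (simp add: quasi_polynomial_graded_def quasi_polynomial_type_zero)

lemma quasi_polynomial_graded_Un:
  assumes "quasi_polynomial_graded deg A" "quasi_polynomial_graded deg B"
    "quasi_polynomial_graded deg (A \<inter> B)"
  shows "quasi_polynomial_graded deg (A \<union> B)"
proof -
  have split: "{x \<in> A \<union> B. deg x = i} = {x \<in> A. deg x = i} \<union> {x \<in> B. deg x = i}"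
    "{x \<in> A \<inter> B. deg x = i} = {x \<in> A. deg x = i} \<inter> {x \<in> B. deg x = i}" for i
    by auto
  have fin: "finite {x \<in> A. deg x = i}" "finite {x \<in> B. deg x = i}" for i
    using assms by (auto simp: quasi_polynomial_graded_def)
  have card: "(of_nat (card {x \<in> A \<union> B. deg x = i}) :: complex) =
      (of_nat (card {x \<in> A. deg x = i}) + 1 * of_nat (card {x \<in> B. deg x = i})) +
      (- 1) * of_nat (card {x \<in> A \<inter> B. deg x = i})" for i
    using arg_cong[OF card_Un_Int[OF fin(1)[of i] fin(2)[of i]], of "of_nat :: nat \<Rightarrow> complex"]
    unfolding split by (simp add: algebra_simps)
  have "quasi_polynomial_type (\<lambda>i. of_nat (card {x \<in> A \<union> B. deg x = i}))"
    unfolding card using assms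
    by (intro quasi_polynomial_type_lincomb) (auto simp: quasi_polynomial_graded_def)
  with fin show ?thesis unfolding quasi_polynomial_graded_def split(1) by simp
qed

lemma quasi_polynomial_graded_Diff:
  assumes "quasi_polynomial_graded deg A" "quasi_polynomial_graded deg B" "B \<subseteq> A"
  shows "quasi_polynomial_graded deg (A - B)"
proof -
  have split: "{x \<in> A - B. deg x = i} = {x \<in> A. deg x = i} - {x \<in> B. deg x = i}" for i
    by auto
  have fin: "finite {x \<in> A. deg x = i}" "finite {x \<in> B. deg x = i}" for i
    using assms by (auto simp: quasi_polynomial_graded_def)
  have sub: "{x \<in> B. deg x = i} \<subseteq> {x \<in> A. deg x = i}" for i
    using assms(3) by auto
  have card: "(of_nat (card {x \<in> A - B. deg x = i}) :: complex) =
      of_nat (card {x \<in> A. deg x = i}) + (- 1) * of_nat (card {x \<in> B. deg x = i})" for i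
    unfolding split card_Diff_subset[OF fin(2) sub]
    by (simp add: of_nat_diff card_mono[OF fin(1) sub])
  have "quasi_polynomial_type (\<lambda>i. of_nat (card {x \<in> A - B. deg x = i}))"
    unfolding card using assms
    by (intro quasi_polynomial_type_lincomb) (auto simp: quasi_polynomial_graded_def)
  with fin show ?thesis unfolding quasi_polynomial_graded_def split(1) by simp
qed

lemma quasi_polynomial_graded_image:
  assumes "quasi_polynomial_graded deg A" "inj_on f A" "\<And>x. x \<in> A \<Longrightarrow> deg' (f x) = c + deg x"
  shows "quasi_polynomial_graded deg' (f ` A)"
proof -
  have eq: "{y \<in> f ` A. deg' y = i} = (if c \<le> i then f ` {x \<in> A. deg x = i - c} else {})" for i
    using assms(3) by auto
  have "inj_on f {x \<in> A. deg x = i - c}" for i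
    using assms(2) by (rule inj_on_subset) auto
  then have card: "(of_nat (card {y \<in> f ` A. deg' y = i}) :: complex) =
      (if c \<le> i then of_nat (card {x \<in> A. deg x = i - c}) else 0)" for i
    unfolding eq by (simp add: card_image)
  have "quasi_polynomial_type (\<lambda>i. of_nat (card {y \<in> f ` A. deg' y = i}))"
    unfolding card using assms(1)
    by (intro quasi_polynomial_type_shift) (simp add: quasi_polynomial_graded_def)
  moreover have "finite {y \<in> f ` A. deg' y = i}" for i
    unfolding eq using assms(1) by (simp add: quasi_polynomial_graded_def)
  ultimately show ?thesis by (simp add: quasi_polynomial_graded_def)
qed

text \<open>Inclusion-exclusion, one set at a time. The induction also carries the intersections of
  the partial union with all members of \<open>\<C>\<close>, as adding \<open>Y\<close> requires the
  count of its overlap with the union so far.\<close>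

lemma quasi_polynomial_graded_Union:
  assumes "finite \<X>" "\<X> \<subseteq> \<C>"
    and Int: "\<And>X Y. X \<in> \<C> \<Longrightarrow> Y \<in> \<C> \<Longrightarrow> X \<inter> Y \<in> \<C>"
    and qp: "\<And>X. X \<in> \<C> \<Longrightarrow> quasi_polynomial_graded deg X"
  shows "quasi_polynomial_graded deg (\<Union>\<X>)"
proof -
  have "quasi_polynomial_graded deg (\<Union>\<X>) \<and> (\<forall>Z\<in>\<C>. quasi_polynomial_graded deg (\<Union>\<X> \<inter> Z))"
    using assms(1,2)
  proof (induction \<X> rule: finite_induct)
    case empty
    then show ?case by (simp add: quasi_polynomial_graded_empty)
  next
    case (insert Y \<X>)
    then have Y: "Y \<in> \<C>" and IH: "quasi_polynomial_graded deg (\<Union>\<X>)"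
      "\<And>Z. Z \<in> \<C> \<Longrightarrow> quasi_polynomial_graded deg (\<Union>\<X> \<inter> Z)" by auto
    have "quasi_polynomial_graded deg (\<Union>\<X> \<union> Y)"
      using Y IH qp by (intro quasi_polynomial_graded_Un) auto
    moreover have "quasi_polynomial_graded deg ((\<Union>\<X> \<inter> Z) \<union> (Y \<inter> Z))" if Z: "Z \<in> \<C>" for Z
    proof (rule quasi_polynomial_graded_Un)
      have "\<Union>\<X> \<inter> Z \<inter> (Y \<inter> Z) = \<Union>\<X> \<inter> (Y \<inter> Z)" by auto
      then show "quasi_polynomial_graded deg (\<Union>\<X> \<inter> Z \<inter> (Y \<inter> Z))"
        using IH(2)[OF Int[OF Y Z]] by simp
    qed (use IH(2)[OF Z] qp[OF Int[OF Y Z]] in auto)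
    moreover have "\<Union>(insert Y \<X>) = \<Union>\<X> \<union> Y" "\<Union>(insert Y \<X>) \<inter> Z = (\<Union>\<X> \<inter> Z) \<union> (Y \<inter> Z)" for Z
      by auto
    ultimately show ?case by simp
  qed
  then show ?thesis ..
qed

lemma quasi_polynomial_graded_multisets:
  fixes d :: "'i \<Rightarrow> nat"
  assumes "finite I" "\<And>i. i \<in> I \<Longrightarrow> d i > 0"
  shows "quasi_polynomial_graded (\<lambda>M. \<Sum>i\<in>#M. d i) {M. set_mset M \<subseteq> I}"
  using assms
proof (induction I rule: finite_induct)
  case empty
  have "{M. set_mset M \<subseteq> {} \<and> (\<Sum>i\<in>#M. d i) = m} = (if m = 0 then {{#}} else {})" for m
    by auto
  \<comment> \<open>The count is \<open>1\<close> at weight \<open>0\<close> and vanishes from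
    weight \<open>1\<close> on.\<close>
  then show ?case
    unfolding quasi_polynomial_graded_def
    by (auto intro!: quasi_polynomial_type_eventually_eq[OF quasi_polynomial_type_zero, of 0])
next
  case (insert a I)
  define S where "S J m = {M. set_mset M \<subseteq> J \<and> (\<Sum>i\<in>#M. d i) = m}" for J m
  have da: "d a > 0" using insert by simp
  have IH: "\<And>m. finite (S I m)" "quasi_polynomial_type (\<lambda>m. of_nat (card (S I m)))"
    using insert by (auto simp: quasi_polynomial_graded_def S_def)
  \<comment> \<open>A multiset either avoids \<open>a\<close> or loses one copy of it; the latter is
    a bijection onto the multisets of weight \<open>m - d a\<close>.\<close>
  have rec: "S (insert a I) m = S I m \<union> (if d a \<le> m then add_mset a ` S (insert a I) (m - d a) else {})"
    (is "?L = ?R") for m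
  proof (intro equalityI subsetI)
    fix M assume M: "M \<in> ?L"
    show "M \<in> ?R"
    proof (cases "a \<in># M")
      case True
      then obtain M' where "M = add_mset a M'" by (metis insert_DiffM)
      with M show ?thesis by (auto simp: S_def)
    next
      case False
      with M show ?thesis by (auto simp: S_def)
    qed
  qed (auto simp: S_def split: if_splits)
  have fin: "finite (S (insert a I) m)" for m
  proof (induction m rule: less_induct)
    case (less m)
    then show ?case using IH(1)[of m] da by (subst rec) auto
  qed
  have "card (S (insert a I) (m + d a)) = card (S (insert a I) m) + card (S I (m + d a))" for m
  proof -
    have "S I (m + d a) \<inter> add_mset a ` S (insert a I) m = {}"
      using insert.hyps(2) by (auto simp: S_def)
    moreover have "inj_on (add_mset a) (S (insert a I) m)" by (simp add: inj_on_def)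
    ultimately show ?thesis
      using IH(1) fin by (subst rec) (simp add: card_Un_disjoint card_image)
  qed
  then have "quasi_polynomial_type (\<lambda>m. of_nat (card (S (insert a I) m)))"
    by (intro quasi_polynomial_type_recurrence[OF IH(2) da]) simp
  with fin show ?case by (simp add: quasi_polynomial_graded_def S_def)
qed

text \<open>By Dickson's lemma an up-closed set is a finite union of cones. Two cones meet in the
  cone at the join \<open>N \<union># N'\<close>, and a cone is a translate of the set of all
  exponents, whose counts are known.\<close>

lemma quasi_polynomial_graded_upclosed:
  fixes d :: "'i \<Rightarrow> nat"
  assumes I: "finite I" "\<And>i. i \<in> I \<Longrightarrow> d i > 0"
    and U: "U \<subseteq> {M. set_mset M \<subseteq> I}"
    and up: "\<And>M N. M \<in> U \<Longrightarrow> set_mset N \<subseteq> I \<Longrightarrow> M + N \<in> U"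
  shows "quasi_polynomial_graded (\<lambda>M. \<Sum>i\<in>#M. d i) U"
proof -
  define cone where "cone B = {M. set_mset M \<subseteq> I \<and> B \<subseteq># M}" for B
  have "\<exists>B\<subseteq>U. finite B \<and> (\<forall>M\<in>U. \<exists>N\<in>B. N \<subseteq># M)"
    using I(1) by (rule dickson_multiset) (use U in auto)
  then obtain B where B: "B \<subseteq> U" "finite B" "\<forall>M\<in>U. \<exists>N\<in>B. N \<subseteq># M"
    by (elim exE conjE)
  have cone: "cone N = (+) N ` {M. set_mset M \<subseteq> I}" if "set_mset N \<subseteq> I" for N
  proof (intro equalityI subsetI)
    fix M assume M: "M \<in> cone N"
    then have "M = N + (M - N)" by (simp add: cone_def)
    moreover have "set_mset (M - N) \<subseteq> I" using M by (auto simp: cone_def dest: in_diffD)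
    ultimately show "M \<in> (+) N ` {M. set_mset M \<subseteq> I}" by blast
  qed (use that in \<open>auto simp: cone_def\<close>)
  have "U = \<Union>(cone ` B)"
  proof (intro equalityI subsetI)
    fix M assume "M \<in> U"
    with B(3) U show "M \<in> \<Union>(cone ` B)" by (auto simp: cone_def)
  next
    fix M assume "M \<in> \<Union>(cone ` B)"
    then obtain N where N: "N \<in> B" "M \<in> cone N" by blast
    then have "N \<in> U" "set_mset N \<subseteq> I" using B(1) U by auto
    with N(2) up[of N] show "M \<in> U" by (auto simp: cone)
  qed
  moreover have "quasi_polynomial_graded (\<lambda>M. \<Sum>i\<in>#M. d i) (\<Union>(cone ` B))"
  proof (rule quasi_polynomial_graded_Union[where \<C> = "cone ` {N. set_mset N \<subseteq> I}"])
    show "cone ` B \<subseteq> cone ` {N. set_mset N \<subseteq> I}" using B(1) U by (intro image_mono) blast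
    show "finite (cone ` B)" using B(2) by simp
  next
    fix X Y assume "X \<in> cone ` {N. set_mset N \<subseteq> I}" "Y \<in> cone ` {N. set_mset N \<subseteq> I}"
    then obtain N N' where N: "X = cone N" "Y = cone N'" "set_mset N \<subseteq> I" "set_mset N' \<subseteq> I"
      by blast
    have "X \<inter> Y = cone (N \<union># N')" unfolding N(1,2) by (auto simp: cone_def)
    moreover have "set_mset (N \<union># N') \<subseteq> I" using N by simp
    ultimately show "X \<inter> Y \<in> cone ` {N. set_mset N \<subseteq> I}" by blast
  next
    fix X assume "X \<in> cone ` {N. set_mset N \<subseteq> I}"
    then obtain N where N: "X = cone N" "set_mset N \<subseteq> I" by blast
    show "quasi_polynomial_graded (\<lambda>M. \<Sum>i\<in>#M. d i) X"
      unfolding N(1) cone[OF N(2)]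
      by (rule quasi_polynomial_graded_image[OF quasi_polynomial_graded_multisets[OF I]]) auto
  qed
  ultimately show ?thesis by simp
qed

text \<open>
  The multiset order on \<open>nat multiset\<close> is a well-order compatible with addition, so it serves as a
  term order: the exponents that are not least among those with the same value form an up-closed
  set, and the remaining ones enumerate the monoid without repetition. The generators in \<open>F\<close> are
  added one at a time.
\<close>

lemma quasi_polynomial_graded_fg_module:
  fixes X :: "'a::cancel_comm_monoid_add set"
  assumes C: "add_submonoid C"
    and deg_add: "\<And>x y. x \<in> C \<Longrightarrow> y \<in> C \<Longrightarrow> deg (x + y) = deg x + deg y"
    and deg_pos: "\<And>x. x \<in> C \<Longrightarrow> x \<noteq> 0 \<Longrightarrow> deg x > 0"
    and X: "fg_module C X"
  shows "quasi_polynomial_graded deg X"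
proof -
  obtain F R where FR: "finite F" "finite R" "F \<subseteq> C" "R \<subseteq> C" "X = F + gen R"
    using X unfolding fg_module_def by blast
  \<comment> \<open>A zero generator would have degree \<open>0\<close> and give infinitely many
    exponents of the same weight.\<close>
  define R' where "R' = R - {0}"
  have "x \<in> gen R'" if "x \<in> R" for x
    using that gen.zero[of R'] gen_base[of x R'] by (cases "x = 0") (auto simp: R'_def)
  then have "gen R \<subseteq> gen R'"
    by (intro gen_least[OF add_submonoid_gen]) blast
  then have R': "gen R = gen R'" using gen_mono[of R' R] by (auto simp: R'_def)
  obtain r :: "nat \<Rightarrow> 'a" and k where r: "R' = r ` {..<k}"
    using finite_imp_nat_seg_image_inj_on[of R'] FR(2) by (auto simp: R'_def lessThan_def)
  define A where "A = {M. set_mset M \<subseteq> {..<k}}"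
  define val where "val M = (\<Sum>i\<in>#M. r i)" for M
  define wt where "wt M = (\<Sum>i\<in>#M. deg (r i))" for M
  have val_add: "val (M + N) = val M + val N" for M N by (simp add: val_def)
  have A_add: "M \<in> A \<Longrightarrow> N \<in> A \<Longrightarrow> M + N \<in> A" for M N by (auto simp: A_def)
  have genA: "gen R = val ` A" unfolding R' r gen_eq_sum_mset by (auto simp: A_def val_def)
  have rC: "r i \<in> C" "r i \<noteq> 0" if "i < k" for i
  proof -
    have "r i \<in> R'" using r that by auto
    then show "r i \<in> C" "r i \<noteq> 0" using FR(4) by (auto simp: R'_def)
  qed
  have genC: "gen R \<subseteq> C" using C FR(4) by (rule gen_least)
  have "deg (0 + 0) = deg 0 + deg 0"
    using C by (intro deg_add) (auto simp: add_submonoid_def)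
  then have deg0: "deg 0 = 0" by simp
  have deg_val: "deg (val M) = wt M" if "M \<in> A" for M
    using that
  proof (induction M)
    case empty
    then show ?case by (simp add: val_def wt_def deg0)
  next
    case (add i M)
    then have "M \<in> A" "i < k" by (auto simp: A_def)
    moreover from this have "val M \<in> C" using genA genC by blast
    ultimately show ?case
      using add.IH rC(1) deg_add[of "r i" "val M"] by (simp add: val_def wt_def)
  qed
  have qpA: "quasi_polynomial_graded wt U"
    if "U \<subseteq> A" "\<And>M N. M \<in> U \<Longrightarrow> N \<in> A \<Longrightarrow> M + N \<in> U" for U
    unfolding wt_def
    by (rule quasi_polynomial_graded_upclosed[of "{..<k}"]) (use that rC deg_pos in \<open>auto simp: A_def\<close>)
  have "quasi_polynomial_graded deg (F + gen R)"
    using FR(1,3)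
  proof (induction F rule: finite_induct)
    case empty
    then show ?case by (simp add: quasi_polynomial_graded_empty)
  next
    case (insert f F)
    define Y where "Y = F + gen R"
    have Y_add: "y + s \<in> Y" if "y \<in> Y" "s \<in> gen R" for y s
      using that gen_plus_closed by (fastforce simp: Y_def add.assoc elim!: set_plus_elim)
    \<comment> \<open>The nonstandard exponents for \<open>f\<close>: the value is already reached
      from \<open>F\<close>, or a smaller exponent has the same value. Both properties survive the
      addition of an exponent, the second because the order is compatible with addition.\<close>
    define T where "T = {M \<in> A. f + val M \<in> Y \<or> (\<exists>M'\<in>A. M' < M \<and> val M' = val M)}"
    have "M + N \<in> T" if "M \<in> T" "N \<in> A" for M N
    proof -
      have "f + val (M + N) \<in> Y" if "f + val M \<in> Y"
        using Y_add[OF that, of "val N"] \<open>N \<in> A\<close> genA by (auto simp: val_add add.assoc)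
      moreover have "\<exists>L\<in>A. L < M + N \<and> val L = val (M + N)" if "M' \<in> A" "M' < M" "val M' = val M" for M'
        using that A_add[OF that(1) \<open>N \<in> A\<close>] by (intro bexI[of _ "M' + N"]) (auto simp: val_add)
      ultimately show ?thesis using that A_add unfolding T_def by blast
    qed
    then have "quasi_polynomial_graded wt (A - T)"
      using A_add by (intro quasi_polynomial_graded_Diff qpA) (auto simp: T_def)
    moreover have "inj_on (\<lambda>M. f + val M) (A - T)"
    proof (rule inj_onI)
      fix M N assume MN: "M \<in> A - T" "N \<in> A - T" "f + val M = f + val N"
      then have "val M = val N" by simp
      then have "\<not> M < N" "\<not> N < M" using MN(1,2) by (auto simp: T_def)
      then show "M = N" by simp
    qed
    moreover have "deg (f + val M) = deg f + wt M" if "M \<in> A - T" for M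
      using that genA genC insert.prems by (subst deg_add) (auto simp: deg_val)
    ultimately have qp: "quasi_polynomial_graded deg ((\<lambda>M. f + val M) ` (A - T))"
      by (rule quasi_polynomial_graded_image)
    have "insert f F + gen R = Y \<union> (\<lambda>M. f + val M) ` (A - T)"
    proof (intro equalityI subsetI)
      fix x assume "x \<in> insert f F + gen R"
      then consider "x \<in> Y" | s where "x = f + s" "s \<in> gen R" "x \<notin> Y"
        by (auto simp: Y_def elim!: set_plus_elim)
      then show "x \<in> Y \<union> (\<lambda>M. f + val M) ` (A - T)"
      proof cases
        case 2
        \<comment> \<open>The normal form of \<open>s\<close>; it exists because the multiset order
          on \<open>nat multiset\<close> is a well-order.\<close>
        define M where "M = (LEAST M. M \<in> A \<and> val M = s)"
        have "\<exists>M. M \<in> A \<and> val M = s" using 2(2) genA by auto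
        then have M: "M \<in> A \<and> val M = s" unfolding M_def by (rule LeastI_ex)
        have "\<not> (\<exists>M'\<in>A. M' < M \<and> val M' = val M)"
          using M not_less_Least[of _ "\<lambda>M. M \<in> A \<and> val M = s"] unfolding M_def by metis
        with M 2 have "M \<in> A - T" "x = f + val M" by (auto simp: T_def)
        then show ?thesis by blast
      qed simp
    next
      fix x assume "x \<in> Y \<union> (\<lambda>M. f + val M) ` (A - T)"
      then show "x \<in> insert f F + gen R"
        using genA by (auto simp: Y_def elim!: set_plus_elim intro!: set_plus_intro)
    qed
    moreover have "Y \<inter> (\<lambda>M. f + val M) ` (A - T) = {}" by (auto simp: T_def)
    ultimately show ?case
      using quasi_polynomial_graded_Un[OF _ qp, of Y] insert
      by (simp add: Y_def quasi_polynomial_graded_empty)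
  qed
  then show ?thesis by (simp add: FR(5))
qed

section \<open>Semilinear sets and path labels\<close>

text \<open>The members of the union may overlap; multiplicities are dealt with only when
  counting.\<close>

definition semilinear :: "'a::comm_monoid_add set \<Rightarrow> 'a set \<Rightarrow> bool" where
  "semilinear C X \<longleftrightarrow> (\<exists>\<X>. finite \<X> \<and> (\<forall>Y\<in>\<X>. fg_module C Y) \<and> X = \<Union>\<X>)"

lemma semilinear_fg_module: "fg_module C X \<Longrightarrow> semilinear C X"
  unfolding semilinear_def by (intro exI[of _ "{X}"]) simp

lemma semilinear_subset:
  assumes "add_submonoid C" "semilinear C X"
  shows "X \<subseteq> C"
proof -
  obtain \<X> where "\<forall>Y\<in>\<X>. fg_module C Y" "X = \<Union>\<X>"
    using assms(2) unfolding semilinear_def by blast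
  with fg_module_subset[OF assms(1)] show ?thesis by blast
qed

lemma semilinear_Un:
  assumes "semilinear C X" "semilinear C Y"
  shows "semilinear C (X \<union> Y)"
proof -
  obtain \<X> where X: "finite \<X>" "\<forall>Y\<in>\<X>. fg_module C Y" "X = \<Union>\<X>"
    using assms(1) unfolding semilinear_def by blast
  obtain \<Y> where Y: "finite \<Y>" "\<forall>Y\<in>\<Y>. fg_module C Y" "Y = \<Union>\<Y>"
    using assms(2) unfolding semilinear_def by blast
  show ?thesis
    unfolding semilinear_def using X Y by (intro exI[of _ "\<X> \<union> \<Y>"]) auto
qed

lemma semilinear_plus:
  assumes "add_submonoid C" "semilinear C X" "semilinear C Y"
  shows "semilinear C (X + Y)"
proof -
  obtain \<X> where X: "finite \<X>" "\<forall>Y\<in>\<X>. fg_module C Y" "X = \<Union>\<X>"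
    using assms(2) unfolding semilinear_def by blast
  obtain \<Y> where Y: "finite \<Y>" "\<forall>Y\<in>\<Y>. fg_module C Y" "Y = \<Union>\<Y>"
    using assms(3) unfolding semilinear_def by blast
  have "X + Y = \<Union>((\<lambda>(A, B). A + B) ` (\<X> \<times> \<Y>))"
    unfolding X(3) Y(3) set_plus_def by auto
  moreover have "\<forall>Z \<in> (\<lambda>(A, B). A + B) ` (\<X> \<times> \<Y>). fg_module C Z"
    using X(2) Y(2) fg_module_plus[OF assms(1)] by auto
  moreover have "finite ((\<lambda>(A, B). A + B) ` (\<X> \<times> \<Y>))" using X(1) Y(1) by simp
  ultimately show ?thesis unfolding semilinear_def by blast
qed

text \<open>The star rule for a linear set: a nonempty sum of elements of \<open>{f} + gen R\<close>
  contains \<open>f\<close> at least once, and once one copy is set aside, the other copies behave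
  like one more period.\<close>

lemma gen_translate:
  "gen ({f} + gen R) = {0} \<union> ({f} + gen (insert f R))" (is "?L = ?R")
proof
  have "add_submonoid ?R"
    unfolding add_submonoid_def
  proof (intro conjI ballI)
    fix x y assume "x \<in> ?R" "y \<in> ?R"
    moreover have "f + a + (f + b) \<in> {f} + gen (insert f R)"
      if "a \<in> gen (insert f R)" "b \<in> gen (insert f R)" for a b
    proof -
      have "a + (f + b) \<in> gen (insert f R)"
        using that by (intro gen_plus_closed gen.add) auto
      then show ?thesis by (simp add: add.assoc set_plus_intro)
    qed
    ultimately show "x + y \<in> ?R" by (auto elim!: set_plus_elim)
  qed simp
  moreover have "{f} + gen R \<subseteq> ?R"
    using gen_mono[of R "insert f R"] by (auto elim!: set_plus_elim intro!: set_plus_intro)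
  ultimately show "?L \<subseteq> ?R" by (rule gen_least)
next
  \<comment> \<open>The copy set aside carries all of \<open>y\<close>; each further copy of
    \<open>f\<close> is the summand \<open>f + 0\<close>.\<close>
  have *: "f + (x + y) \<in> ?L" if "x \<in> gen {f}" "y \<in> gen R" for x y
    using that
  proof (induction rule: gen.induct)
    case zero
    then show ?case by (auto intro!: gen_base)
  next
    case (add r x)
    then have "f + (x + y) \<in> ?L" "r = f" by auto
    moreover have "f + 0 \<in> {f} + gen R" by (intro set_plus_intro gen.zero) simp
    ultimately have "f + 0 + (f + (x + y)) \<in> ?L" using gen.add by blast
    then show ?case using \<open>r = f\<close> by (simp add: add.assoc)
  qed
  have "insert f R = {f} \<union> R" by simp
  then have "gen (insert f R) = gen {f} + gen R" by (simp only: gen_Un)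
  with * show "?R \<subseteq> ?L" by (auto elim!: set_plus_elim intro: gen.zero)
qed

text \<open>By commutativity the monoid generated by a union is the sum of the generated monoids,
  which reduces the claim to a single \<open>{f} + gen R\<close>.\<close>

lemma semilinear_gen:
  assumes C: "add_submonoid C" and "semilinear C X"
  shows "semilinear C (gen X)"
proof -
  obtain \<X> where X: "finite \<X>" "\<forall>Y\<in>\<X>. fg_module C Y" "X = \<Union>\<X>"
    using assms(2) unfolding semilinear_def by blast
  have C0: "{0} \<subseteq> C" using C by (simp add: add_submonoid_def)
  have sl0: "semilinear C {0}"
    using C0 by (intro semilinear_fg_module fg_module_finite) auto
  have module: "semilinear C (gen (F + gen R))"
    if "finite F" "finite R" "F \<subseteq> C" "R \<subseteq> C" for F R
    using that(1,3)
  proof (induction F rule: finite_induct)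
    case empty
    then show ?case using sl0 by (simp add: gen_empty)
  next
    case (insert f F)
    have "insert f F + gen R = ({f} + gen R) \<union> (F + gen R)"
      using Un_set_plus[of "{f}" F "gen R"] by simp
    then have "gen (insert f F + gen R) = ({0} \<union> ({f} + gen (insert f R))) + gen (F + gen R)"
      by (simp only: gen_Un gen_translate)
    moreover have "semilinear C ({f} + gen (insert f R))"
      using insert.prems that by (intro semilinear_fg_module fg_moduleI) auto
    then have "semilinear C ({0} \<union> ({f} + gen (insert f R)))"
      by (rule semilinear_Un[OF sl0])
    ultimately show ?case
      using insert by (simp only: semilinear_plus C insert_subset)
  qed
  have "semilinear C (gen (\<Union>\<X>))"
    using X(1,2)
  proof (induction \<X> rule: finite_induct)
    case empty
    then show ?case using sl0 by (simp add: gen_empty)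
  next
    case (insert Y \<X>)
    then have "fg_module C Y" by simp
    then obtain F R where "finite F" "finite R" "F \<subseteq> C" "R \<subseteq> C" "Y = F + gen R"
      unfolding fg_module_def by blast
    then have "semilinear C (gen Y)" using module by simp
    with insert show ?case by (simp add: gen_Un semilinear_plus C)
  qed
  then show ?thesis by (simp add: X(3))
qed

lemma semilinear_Int_coset:
  fixes X :: "'a::ab_group_add set"
  assumes "add_submonoid C" "semilinear C X" "add_subgroup H"
  shows "semilinear C {x \<in> X. x - c \<in> H}"
proof -
  obtain \<X> where X: "finite \<X>" "\<forall>Y\<in>\<X>. fg_module C Y" "X = \<Union>\<X>"
    using assms(2) unfolding semilinear_def by blast
  have "{x \<in> X. x - c \<in> H} = \<Union>((\<lambda>Y. {x \<in> Y. x - c \<in> H}) ` \<X>)" using X(3) by auto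
  moreover have "\<forall>Y \<in> (\<lambda>Y. {x \<in> Y. x - c \<in> H}) ` \<X>. fg_module C Y"
    using X(2) fg_module_Int_coset[OF assms(1) _ assms(3)] by auto
  ultimately show ?thesis unfolding semilinear_def using X(1) by blast
qed

lemma quasi_polynomial_graded_semilinear:
  fixes X :: "'a::ab_group_add set"
  assumes C: "add_submonoid C"
    and deg_add: "\<And>x y. x \<in> C \<Longrightarrow> y \<in> C \<Longrightarrow> deg (x + y) = deg x + deg y"
    and deg_pos: "\<And>x. x \<in> C \<Longrightarrow> x \<noteq> 0 \<Longrightarrow> deg x > 0"
    and X: "semilinear C X"
  shows "quasi_polynomial_graded deg X"
proof -
  obtain \<X> where X: "finite \<X>" "\<forall>Y\<in>\<X>. fg_module C Y" "X = \<Union>\<X>"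
    using X unfolding semilinear_def by blast
  show ?thesis
    unfolding X(3)
  proof (rule quasi_polynomial_graded_Union[where \<C> = "Collect (fg_module C)"])
    show "quasi_polynomial_graded deg Y" if "Y \<in> Collect (fg_module C)" for Y
      using C deg_add deg_pos that[simplified] by (rule quasi_polynomial_graded_fg_module)
  qed (use X fg_module_Int[OF C] in auto)
qed

text \<open>Labels of nonempty paths in an automaton with transitions \<open>\<Delta>\<close>. The
  set \<open>S\<close> restricts interior states only, not the two ends, as state elimination
  requires.\<close>

inductive_set paths :: "('q \<times> 'a::comm_monoid_add \<times> 'q) set \<Rightarrow> 'q set \<Rightarrow> ('q \<times> 'a \<times> 'q) set"
  for \<Delta> S where
  edge: "(q, l, q') \<in> \<Delta> \<Longrightarrow> (q, l, q') \<in> paths \<Delta> S"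
| step: "(q, l, s) \<in> \<Delta> \<Longrightarrow> s \<in> S \<Longrightarrow> (s, m, q') \<in> paths \<Delta> S \<Longrightarrow> (q, l + m, q') \<in> paths \<Delta> S"

lemma paths_mono:
  assumes "S \<subseteq> T"
  shows "paths \<Delta> S \<subseteq> paths \<Delta> T"
proof (rule subrelI)
  fix q p assume "(q, p) \<in> paths \<Delta> S"
  moreover obtain l q' where "p = (l, q')" by fastforce
  ultimately have "(q, l, q') \<in> paths \<Delta> S" by simp
  then have "(q, l, q') \<in> paths \<Delta> T"
    by (induction rule: paths.induct) (use assms in \<open>auto intro: paths.intros\<close>)
  with \<open>p = (l, q')\<close> show "(q, p) \<in> paths \<Delta> T" by simp
qed

lemma paths_concat:
  assumes "(q, l, s) \<in> paths \<Delta> S" "s \<in> S" "(s, m, q') \<in> paths \<Delta> S"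
  shows "(q, l + m, q') \<in> paths \<Delta> S"
  using assms
proof (induction q l s rule: paths.induct)
  case (edge q l s)
  then show ?case by (intro paths.step)
next
  case (step q l s k t)
  then have "(q, l + (k + m), q') \<in> paths \<Delta> S" by (auto intro: paths.step[of q l s])
  then show ?case by (simp add: add.assoc)
qed

text \<open>Kleene's elimination of the state \<open>s\<close>: cut a path at its first and last visits to \<open>s\<close>.\<close>

lemma paths_insert:
  "{l. (q, l, q') \<in> paths \<Delta> (insert s S)} =
    {l. (q, l, q') \<in> paths \<Delta> S} \<union>
    ({l. (q, l, s) \<in> paths \<Delta> S} + gen {l. (s, l, s) \<in> paths \<Delta> S} + {l. (s, l, q') \<in> paths \<Delta> S})"
proof (intro equalityI subsetI)
  let ?P = "\<lambda>q q'. {l. (q, l, q') \<in> paths \<Delta> S}"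
  fix l assume "l \<in> {l. (q, l, q') \<in> paths \<Delta> (insert s S)}"
  then have "(q, l, q') \<in> paths \<Delta> (insert s S)" by simp
  then show "l \<in> ?P q q' \<union> (?P q s + gen (?P s s) + ?P s q')"
  proof (induction q l q' rule: paths.induct)
    case (edge q l q')
    then show ?case by (auto intro: paths.edge)
  next
    case (step q l t m q')
    from step.IH consider (direct) "m \<in> ?P t q'"
      | (via) a b c where "m = a + b + c" "a \<in> ?P t s" "b \<in> gen (?P s s)" "c \<in> ?P s q'"
      by (auto elim!: set_plus_elim)
    then show ?case
    proof cases
      case direct
      show ?thesis
      proof (cases "t \<in> S")
        case True
        then show ?thesis using direct step.hyps by (auto intro: paths.step)
      next
        case False
        then have "t = s" using step.hyps by simp
        then have "l \<in> ?P q s" "m \<in> ?P s q'" using direct step.hyps by (auto intro: paths.edge)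
        then have "l + 0 + m \<in> ?P q s + gen (?P s s) + ?P s q'"
          by (intro set_plus_intro gen.zero)
        then show ?thesis by simp
      qed
    next
      case via
      show ?thesis
      proof (cases "t \<in> S")
        case True
        then have "l + a \<in> ?P q s" using via step.hyps by (auto intro: paths.step)
        then have "l + a + b + c \<in> ?P q s + gen (?P s s) + ?P s q'"
          using via by (intro set_plus_intro)
        then show ?thesis using via(1) by (simp add: add.assoc)
      next
        case False
        then have t: "t = s" using step.hyps by simp
        then have "l \<in> ?P q s" using step.hyps by (auto intro: paths.edge)
        \<comment> \<open>The new edge already arrives at \<open>s\<close>, so the former initial
          stretch \<open>a\<close> becomes one more loop at \<open>s\<close>.\<close>
        moreover have "a + b \<in> gen (?P s s)" using via t by (intro gen.add) auto
        ultimately have "l + (a + b) + c \<in> ?P q s + gen (?P s s) + ?P s q'"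
          using via by (intro set_plus_intro)
        then show ?thesis using via(1) by (simp add: add.assoc)
      qed
    qed
  qed
next
  let ?P = "\<lambda>q q'. {l. (q, l, q') \<in> paths \<Delta> S}"
  have mono: "p \<in> paths \<Delta> S \<Longrightarrow> p \<in> paths \<Delta> (insert s S)" for p
    using paths_mono[of S "insert s S"] by blast
  have loop: "(s, b + c, q') \<in> paths \<Delta> (insert s S)"
    if "b \<in> gen (?P s s)" "(s, c, q') \<in> paths \<Delta> S" for b c
    using that
    by (induction rule: gen.induct) (auto simp: add.assoc intro: mono paths_concat[of s _ s])
  have "a + b + c \<in> {l. (q, l, q') \<in> paths \<Delta> (insert s S)}"
    if "a \<in> ?P q s" "b \<in> gen (?P s s)" "c \<in> ?P s q'" for a b c
  proof -
    have "(q, a + (b + c), q') \<in> paths \<Delta> (insert s S)"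
      using that by (intro paths_concat[of q a s] mono loop) auto
    then show ?thesis by (simp add: add.assoc)
  qed
  then show "l \<in> {l. (q, l, q') \<in> paths \<Delta> (insert s S)}"
    if "l \<in> ?P q q' \<union> (?P q s + gen (?P s s) + ?P s q')" for l
    using that mono by (auto elim!: set_plus_elim)
qed

lemma semilinear_paths:
  assumes C: "add_submonoid C" and "finite S" "finite \<Delta>"
    and lab: "\<And>q l q'. (q, l, q') \<in> \<Delta> \<Longrightarrow> l \<in> C"
  shows "semilinear C {l. (q, l, q') \<in> paths \<Delta> S}"
  using assms(2)
proof (induction S arbitrary: q q' rule: finite_induct)
  case empty
  have "(q, l, q') \<in> paths \<Delta> {} \<longleftrightarrow> (q, l, q') \<in> \<Delta>" for l
    by (auto elim: paths.cases intro: paths.edge)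
  moreover have "finite {l. (q, l, q') \<in> \<Delta>}"
    using finite_imageI[OF assms(3), of "\<lambda>(q, l, q'). l"] by (rule finite_subset[rotated]) force
  ultimately show ?case
    using lab by (auto intro!: semilinear_fg_module fg_module_finite)
next
  case (insert s S)
  then show ?case
    unfolding paths_insert by (intro semilinear_Un semilinear_plus semilinear_gen C)
qed

section \<open>Periodic graphs\<close>

context periodic_graph
begin

section \<open>Elementary facts on the free action\<close>

sublocale group L
  using verts_action.group_hom by (simp add: group_hom_def)

lemma act_in_verts: "u \<in> carrier L \<Longrightarrow> y \<in> verts \<Gamma> \<Longrightarrow> \<phi> u y \<in> verts \<Gamma>"
  using verts_action.element_image by blast

lemma act_in_arcs: "u \<in> carrier L \<Longrightarrow> e \<in> arcs \<Gamma> \<Longrightarrow> \<psi> u e \<in> arcs \<Gamma>"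
  using arcs_action.element_image by blast

lemma act_one: "y \<in> verts \<Gamma> \<Longrightarrow> \<phi> \<one>\<^bsub>L\<^esub> y = y"
  using verts_action.id_eq_one by (metis restrict_apply')

lemma act_free:
  assumes "y \<in> verts \<Gamma>" "u \<in> carrier L" "v \<in> carrier L" "\<phi> u y = \<phi> v y"
  shows "u = v"
proof -
  have "\<phi> (inv\<^bsub>L\<^esub> v \<otimes>\<^bsub>L\<^esub> u) y = y"
    using assms verts_action.composition_rule verts_action.orbit_sym_aux by simp
  then have "inv\<^bsub>L\<^esub> v \<otimes>\<^bsub>L\<^esub> u = \<one>\<^bsub>L\<^esub>"
    using assms verts_free[OF assms(1)] unfolding stabilizer_def by blast
  then show ?thesis using assms(2,3) by (metis inv_closed inv_equality inv_inv)
qed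

lemma orbit_eq_iff:
  assumes "y \<in> verts \<Gamma>" "z \<in> verts \<Gamma>"
  shows "orbit L \<phi> y = orbit L \<phi> z \<longleftrightarrow> (\<exists>u\<in>carrier L. z = \<phi> u y)"
proof
  assume "orbit L \<phi> y = orbit L \<phi> z"
  then have "z \<in> orbit L \<phi> y" using verts_action.orbit_refl assms by simp
  then show "\<exists>u\<in>carrier L. z = \<phi> u y" by (auto simp: orbit_def)
next
  assume "\<exists>u\<in>carrier L. z = \<phi> u y"
  then have z: "z \<in> orbit L \<phi> y" by (auto simp: orbit_def)
  have sub: "orbit L \<phi> x \<subseteq> verts \<Gamma>" if "x \<in> verts \<Gamma>" for x
    using that act_in_verts by (auto simp: orbit_def)
  show "orbit L \<phi> y = orbit L \<phi> z"
    using z verts_action.orbit_sym[OF assms z] sub assms verts_action.orbit_trans by blast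
qed

lemma orbit_act: "u \<in> carrier L \<Longrightarrow> y \<in> verts \<Gamma> \<Longrightarrow> orbit L \<phi> (\<phi> u y) = orbit L \<phi> y"
  using orbit_eq_iff[of y "\<phi> u y"] act_in_verts by auto

text \<open>The rank \<open>n\<close> is not a type, so coordinate vectors are padded with zeros to
  functions on all naturals: one additive group type then holds the displacements for every
  rank.\<close>

lemma additive_embedding:
  obtains h :: "'l \<Rightarrow> nat \<Rightarrow> int"
  where "inj_on h (carrier L)"
    and "\<And>u v. u \<in> carrier L \<Longrightarrow> v \<in> carrier L \<Longrightarrow> h (u \<otimes>\<^bsub>L\<^esub> v) = h u + h v"
proof -
  obtain n :: nat where "L \<cong> product_group {..<n} (\<lambda>_. integer_group)" using free_abelian by blast
  then obtain g where g: "g \<in> iso L (product_group {..<n} (\<lambda>_. integer_group))"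
    by (auto simp: is_iso_def)
  define h where "h u i = (if i < n then g u i else 0)" for u i
  have hom: "g (u \<otimes>\<^bsub>L\<^esub> v) = (\<lambda>i\<in>{..<n}. g u i + g v i)"
    if "u \<in> carrier L" "v \<in> carrier L" for u v
    using g that by (auto simp: iso_def hom_def product_group_def integer_group_def)
  have carr: "g u \<in> extensional {..<n}" if "u \<in> carrier L" for u
    using g that by (auto simp: iso_def hom_def product_group_def PiE_def)
  have "inj_on h (carrier L)"
  proof (rule inj_onI)
    fix u v assume uv: "u \<in> carrier L" "v \<in> carrier L" "h u = h v"
    have "g u i = g v i" for i
    proof (cases "i < n")
      case True
      then show ?thesis using fun_cong[OF uv(3), of i] by (simp add: h_def)
    next
      case False
      then show ?thesis using carr[OF uv(1)] carr[OF uv(2)] by (simp add: extensional_def)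
    qed
    then have "g u = g v" by (rule ext)
    then show "u = v" using g uv(1,2) by (auto simp: iso_def bij_betw_def dest: inj_onD)
  qed
  moreover have "h (u \<otimes>\<^bsub>L\<^esub> v) = h u + h v" if "u \<in> carrier L" "v \<in> carrier L" for u v
    using hom[OF that] by (auto simp: h_def fun_eq_iff)
  ultimately show ?thesis by (rule that)
qed

text \<open>A representative in each orbit trivializes the free action: a vertex is the translate of
  its representative by a unique \<open>u\<close>, and \<open>h u\<close> is its position. As
  \<open>rep\<close> is chosen from the orbit as a set, it is constant on orbits, which gives
  equivariance.\<close>

lemma position_function:
  assumes "\<And>u v. u \<in> carrier L \<Longrightarrow> v \<in> carrier L \<Longrightarrow> h (u \<otimes>\<^bsub>L\<^esub> v) = h u + h v"
  obtains pos where "\<And>u y. u \<in> carrier L \<Longrightarrow> y \<in> verts \<Gamma> \<Longrightarrow> pos (\<phi> u y) = h u + pos y"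
proof -
  define rep where "rep y = (SOME z. z \<in> orbit L \<phi> y)" for y
  define off where "off y = (THE u. u \<in> carrier L \<and> y = \<phi> u (rep y))" for y
  have rep: "rep y \<in> orbit L \<phi> y" if "y \<in> verts \<Gamma>" for y
    unfolding rep_def using verts_action.orbit_refl[OF that] by (rule someI)
  have rep_verts: "rep y \<in> verts \<Gamma>" if "y \<in> verts \<Gamma>" for y
    using rep[OF that] that act_in_verts by (auto simp: orbit_def)
  have offI: "off y = u" if "y \<in> verts \<Gamma>" "u \<in> carrier L" "y = \<phi> u (rep y)" for y u
    unfolding off_def
    by (rule the_equality) (use that act_free[OF rep_verts[OF that(1)]] in auto)
  have ex: "\<exists>u\<in>carrier L. y = \<phi> u (rep y)" if "y \<in> verts \<Gamma>" for y
    using verts_action.orbit_sym[OF that rep_verts[OF that] rep[OF that]] by (auto simp: orbit_def)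
  have "h (off (\<phi> u y)) = h u + h (off y)" if u: "u \<in> carrier L" and y: "y \<in> verts \<Gamma>" for u y
  proof -
    obtain v where v: "v \<in> carrier L" "y = \<phi> v (rep y)" using ex[OF y] by blast
    have "rep (\<phi> u y) = rep y" using orbit_act[OF u y] by (simp add: rep_def)
    then have "\<phi> u y = \<phi> (u \<otimes>\<^bsub>L\<^esub> v) (rep (\<phi> u y))"
      using v u rep_verts[OF y] by (simp add: verts_action.composition_rule)
    then have "off (\<phi> u y) = u \<otimes>\<^bsub>L\<^esub> v" using u v y by (intro offI act_in_verts) auto
    moreover have "off y = v" using y v by (rule offI)
    ultimately show ?thesis using assms u v by simp
  qed
  then show ?thesis by (rule that)
qed

lemma graph_dist_le_iff:
  "graph_dist \<Gamma> w x y \<le> ereal (real i) \<longleftrightarrow> (\<exists>p. awalk x p y \<and> sum_list (map w p) \<le> i)"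
proof
  assume le: "graph_dist \<Gamma> w x y \<le> ereal (real i)"
  then obtain p where "awalk x p y"
    using graph_dist_no_walk[OF wf_digraph_axioms, of x y w] by fastforce
  then obtain q where "awalk x q y" "graph_dist \<Gamma> w x y = ereal (real (sum_list (map w q)))"
    using graph_dist_attained[OF wf_digraph_axioms] by blast
  with le show "\<exists>p. awalk x p y \<and> sum_list (map w p) \<le> i" by auto
next
  assume "\<exists>p. awalk x p y \<and> sum_list (map w p) \<le> i"
  then obtain p where p: "awalk x p y" "sum_list (map w p) \<le> i" by blast
  have "graph_dist \<Gamma> w x y \<le> ereal (awalk_cost (\<lambda>e. real (w e)) p)"
    unfolding graph_dist_def \<mu>_def using p(1) by (intro INF_lower) simp
  also have "awalk_cost (\<lambda>e. real (w e)) p = real (sum_list (map w p))"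
    by (induction p) (auto simp: awalk_cost_def)
  finally show "graph_dist \<Gamma> w x y \<le> ereal (real i)"
    using p(2) by (meson ereal_less_eq(3) of_nat_le_iff order_trans)
qed

end

section \<open>Positions of vertices and labels of walks\<close>

locale positioned_periodic_graph = periodic_graph \<Gamma> w L \<phi> \<psi>
  for \<Gamma> :: "('v, 'e) pre_digraph"
    and w :: "'e \<Rightarrow> nat"
    and L :: "('l, 'm) monoid_scheme"
    and \<phi> :: "'l \<Rightarrow> 'v \<Rightarrow> 'v"
    and \<psi> :: "'l \<Rightarrow> 'e \<Rightarrow> 'e" +
  fixes h :: "'l \<Rightarrow> 'a::ab_group_add"
    and pos :: "'v \<Rightarrow> 'a"
  assumes h_inj: "inj_on h (carrier L)"
    and h_mult: "u \<in> carrier L \<Longrightarrow> v \<in> carrier L \<Longrightarrow> h (u \<otimes>\<^bsub>L\<^esub> v) = h u + h v"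
    and pos_act: "u \<in> carrier L \<Longrightarrow> y \<in> verts \<Gamma> \<Longrightarrow> pos (\<phi> u y) = h u + pos y"
begin

lemma h_one: "h \<one>\<^bsub>L\<^esub> = 0"
  using h_mult[of "\<one>\<^bsub>L\<^esub>" "\<one>\<^bsub>L\<^esub>"] by simp

lemma h_m_inv: "u \<in> carrier L \<Longrightarrow> h (inv\<^bsub>L\<^esub> u) = - h u"
  using h_mult[of "inv\<^bsub>L\<^esub> u" u] h_one by (simp add: eq_neg_iff_add_eq_0)

text \<open>The translation taking \<open>y\<close> to \<open>z\<close> has image \<open>0\<close>
  under the injective \<open>h\<close>, so it is trivial. Thus vertices of one orbit can be counted
  by their displacements.\<close>

lemma pos_inj:
  assumes "y \<in> verts \<Gamma>" "z \<in> verts \<Gamma>" "orbit L \<phi> y = orbit L \<phi> z" "pos y = pos z"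
  shows "y = z"
proof -
  obtain u where u: "u \<in> carrier L" "z = \<phi> u y" using assms orbit_eq_iff by blast
  then have "h u = h \<one>\<^bsub>L\<^esub>" using pos_act[of u y] assms h_one by simp
  then have "u = \<one>\<^bsub>L\<^esub>" using h_inj u(1) by (auto dest: inj_onD)
  then show ?thesis using u(2) assms(1) act_one by simp
qed

text \<open>The transition that an arc induces in the quotient automaton, whose states are the
  vertex orbits. Taking the difference of positions makes it invariant under
  \<open>L\<close>.\<close>

definition arc_label :: "'e \<Rightarrow> 'v set \<times> ('a \<times> int) \<times> 'v set" where
  "arc_label e =
    (orbit L \<phi> (tail \<Gamma> e), (pos (head \<Gamma> e) - pos (tail \<Gamma> e), int (w e)), orbit L \<phi> (head \<Gamma> e))"

lemma arc_label_act:
  assumes "u \<in> carrier L" "e \<in> arcs \<Gamma>"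
  shows "arc_label (\<psi> u e) = arc_label e"
  using assms by (simp add: arc_label_def tail_compat head_compat weight_compat orbit_act pos_act)

lemma finite_arc_labels: "finite (arc_label ` arcs \<Gamma>)"
proof -
  have "arc_label ` arcs \<Gamma> \<subseteq> (\<lambda>\<O>. arc_label (SOME e. e \<in> \<O>)) ` orbits L (arcs \<Gamma>) \<psi>"
  proof
    fix l assume "l \<in> arc_label ` arcs \<Gamma>"
    then obtain e where e: "e \<in> arcs \<Gamma>" "l = arc_label e" by blast
    define e' where "e' = (SOME e'. e' \<in> orbit L \<psi> e)"
    have "e' \<in> orbit L \<psi> e"
      unfolding e'_def using arcs_action.orbit_refl[OF e(1)] by (rule someI)
    then have "arc_label e' = l" using e arc_label_act by (auto simp: orbit_def)
    moreover have "orbit L \<psi> e \<in> orbits L (arcs \<Gamma>) \<psi>" using e by (auto simp: orbits_def)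
    ultimately show "l \<in> (\<lambda>\<O>. arc_label (SOME e. e \<in> \<O>)) ` orbits L (arcs \<Gamma>) \<psi>"
      unfolding e'_def by blast
  qed
  then show ?thesis using arcs_orbits by (blast intro: finite_subset)
qed

text \<open>All orbits are allowed as interior states. Empty walks have no counterpart here and need
  a separate label \<open>0\<close>.\<close>

abbreviation walk_labels :: "('v set \<times> ('a \<times> int) \<times> 'v set) set" where
  "walk_labels \<equiv> paths (arc_label ` arcs \<Gamma>) (orbits L (verts \<Gamma>) \<phi>)"

lemma walk_label:
  assumes "awalk x p y" "p \<noteq> []"
  shows "(orbit L \<phi> x, (pos y - pos x, int (sum_list (map w p))), orbit L \<phi> y) \<in> walk_labels"
  using assms
proof (induction p arbitrary: x)
  case (Cons e p)
  let ?z = "head \<Gamma> e"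
  have e: "e \<in> arcs \<Gamma>" "x = tail \<Gamma> e" "awalk ?z p y" using Cons.prems by (auto simp: awalk_Cons_iff)
  have lab: "(orbit L \<phi> x, (pos ?z - pos x, int (w e)), orbit L \<phi> ?z) \<in> arc_label ` arcs \<Gamma>"
    using e by (auto simp: arc_label_def image_iff)
  show ?case
  proof (cases "p = []")
    case True
    then have "y = ?z" using e(3) by (simp add: awalk_Nil_iff)
    then show ?thesis using lab True by (auto intro: paths.edge)
  next
    case False
    have "orbit L \<phi> ?z \<in> orbits L (verts \<Gamma>) \<phi>" using e(1) by (auto simp: orbits_def)
    from paths.step[OF lab this Cons.IH[OF e(3) False]] show ?thesis by simp
  qed
qed simp

text \<open>Path lifting along the quotient map: an arc whose tail lies in the orbit of
  \<open>x\<close> has a translate with tail \<open>x\<close> and the same label.\<close>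

lemma walk_label_lift:
  assumes "(q, l, q') \<in> walk_labels" "x \<in> verts \<Gamma>" "orbit L \<phi> x = q"
  shows "\<exists>p y. awalk x p y \<and> orbit L \<phi> y = q' \<and> l = (pos y - pos x, int (sum_list (map w p)))"
proof -
  have arc: "\<exists>e'\<in>arcs \<Gamma>. tail \<Gamma> e' = x \<and> arc_label e' = arc_label e"
    if e: "e \<in> arcs \<Gamma>" and x: "x \<in> verts \<Gamma>" "orbit L \<phi> x = orbit L \<phi> (tail \<Gamma> e)" for e x
  proof -
    have "orbit L \<phi> (tail \<Gamma> e) = orbit L \<phi> x" using x(2) by simp
    then obtain u where "u \<in> carrier L" "x = \<phi> u (tail \<Gamma> e)"
      using e x(1) orbit_eq_iff[of "tail \<Gamma> e" x] by auto
    then show ?thesis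
      using e by (intro bexI[of _ "\<psi> u e"]) (auto simp: tail_compat arc_label_act act_in_arcs)
  qed
  show ?thesis
    using assms
  proof (induction q l q' arbitrary: x rule: paths.induct)
    case (edge q l q')
    then obtain e where "e \<in> arcs \<Gamma>" "(q, l, q') = arc_label e" by blast
    with edge.prems arc[of e x]
    obtain e' where e': "e' \<in> arcs \<Gamma>" "tail \<Gamma> e' = x" "(q, l, q') = arc_label e'"
      by (auto simp: arc_label_def)
    then show ?case
      by (intro exI[of _ "[e']"] exI[of _ "head \<Gamma> e'"])
        (auto simp: arc_label_def awalk_Cons_iff awalk_Nil_iff)
  next
    case (step q l s m q')
    then obtain e where "e \<in> arcs \<Gamma>" "(q, l, s) = arc_label e" by blast
    with step.prems arc[of e x]
    obtain e' where e': "e' \<in> arcs \<Gamma>" "tail \<Gamma> e' = x" "(q, l, s) = arc_label e'"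
      by (auto simp: arc_label_def)
    then have "head \<Gamma> e' \<in> verts \<Gamma>" "orbit L \<phi> (head \<Gamma> e') = s" by (auto simp: arc_label_def)
    from step.IH[OF this] obtain p y where "awalk (head \<Gamma> e') p y" "orbit L \<phi> y = q'"
      "m = (pos y - pos (head \<Gamma> e'), int (sum_list (map w p)))" by blast
    with e' show ?case
      by (intro exI[of _ "e' # p"] exI[of _ y]) (auto simp: arc_label_def awalk_Cons_iff)
  qed
qed

definition positive_labels :: "('a \<times> int) set" where
  "positive_labels = insert 0 {l. snd l > 0}"

lemma add_submonoid_positive_labels: "add_submonoid positive_labels"
  by (auto simp: add_submonoid_def positive_labels_def)

text \<open>The generator \<open>(0, 1)\<close> turns \<open>weight = i\<close> into \<open>weight \<le> i\<close>.\<close>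

definition ball_labels :: "'v \<Rightarrow> 'v set \<Rightarrow> ('a \<times> int) set" where
  "ball_labels x q =
    ({l. (orbit L \<phi> x, l, q) \<in> walk_labels} \<union> (if q = orbit L \<phi> x then {0} else {})) + gen {(0, 1)}"

lemma gen_unit_weight: "gen {(0 :: 'a, 1 :: int)} = range (\<lambda>n. (0, int n))"
proof (intro equalityI subsetI)
  fix l :: "'a \<times> int" assume "l \<in> gen {(0, 1)}"
  then show "l \<in> range (\<lambda>n. (0, int n))"
  proof (induction rule: gen.induct)
    case zero
    show ?case by (auto simp: zero_prod_def intro!: image_eqI[of _ _ 0])
  next
    case (add r l)
    then obtain n where "l = (0, int n)" "r = (0, 1)" by auto
    then show ?case by (auto intro!: image_eqI[of _ _ "Suc n"])
  qed
next
  have "(0 :: 'a, int n) \<in> gen {(0, 1)}" for n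
  proof (induction n)
    case 0
    show ?case using gen.zero[of "{(0 :: 'a, 1 :: int)}"] by (simp add: zero_prod_def)
  next
    case (Suc n)
    from gen.add[OF _ this, of "(0, 1)"] show ?case by (simp add: add.commute)
  qed
  then show "l \<in> gen {(0, 1)}" if "l \<in> range (\<lambda>n. (0 :: 'a, int n))" for l using that by auto
qed

lemma semilinear_ball_labels: "semilinear positive_labels (ball_labels x q)"
  unfolding ball_labels_def
proof (intro semilinear_plus semilinear_Un semilinear_paths semilinear_gen
    add_submonoid_positive_labels verts_orbits finite_arc_labels)
  show "l \<in> positive_labels" if "(q, l, q') \<in> arc_label ` arcs \<Gamma>" for q l q'
    using that weight_pos by (auto simp: arc_label_def positive_labels_def)
qed (auto intro!: semilinear_fg_module fg_module_finite simp: positive_labels_def)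

lemma mem_ball_labels_iff:
  assumes "x \<in> verts \<Gamma>" "y \<in> verts \<Gamma>"
  shows "(pos y - pos x, int i) \<in> ball_labels x (orbit L \<phi> y) \<longleftrightarrow> graph_dist \<Gamma> w x y \<le> ereal (real i)"
  unfolding graph_dist_le_iff
proof
  assume "(pos y - pos x, int i) \<in> ball_labels x (orbit L \<phi> y)"
  then obtain l n where l: "(pos y - pos x, int i) = l + (0, int n)"
    "(orbit L \<phi> x, l, orbit L \<phi> y) \<in> walk_labels \<or> orbit L \<phi> y = orbit L \<phi> x \<and> l = 0"
    unfolding ball_labels_def gen_unit_weight by (auto elim!: set_plus_elim split: if_splits)
  from l(2) have "\<exists>p z. awalk x p z \<and> orbit L \<phi> z = orbit L \<phi> y \<and>
      l = (pos z - pos x, int (sum_list (map w p)))"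
  proof
    assume "(orbit L \<phi> x, l, orbit L \<phi> y) \<in> walk_labels"
    then show ?thesis using assms(1) by (rule walk_label_lift) simp
  next
    assume "orbit L \<phi> y = orbit L \<phi> x \<and> l = 0"
    then show ?thesis using assms(1)
      by (intro exI[of _ "[]"] exI[of _ x]) (simp add: awalk_Nil_iff zero_prod_def)
  qed
  then obtain p z where z: "awalk x p z" "orbit L \<phi> z = orbit L \<phi> y"
    "l = (pos z - pos x, int (sum_list (map w p)))"
    by blast
  \<comment> \<open>The lift ends at some vertex of the right orbit; its position, fixed by the
    displacement, identifies it.\<close>
  then have "z = y" using l(1) assms(2) by (intro pos_inj) auto
  moreover have "sum_list (map w p) \<le> i" using z(3) l(1) by simp
  ultimately show "\<exists>p. awalk x p y \<and> sum_list (map w p) \<le> i" using z(1) by blast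
next
  assume "\<exists>p. awalk x p y \<and> sum_list (map w p) \<le> i"
  then obtain p where p: "awalk x p y" "sum_list (map w p) \<le> i" by blast
  define l where "l = (pos y - pos x, int (sum_list (map w p)))"
  have "l \<in> {l. (orbit L \<phi> x, l, orbit L \<phi> y) \<in> walk_labels} \<union>
      (if orbit L \<phi> y = orbit L \<phi> x then {0} else {})"
  proof (cases "p = []")
    case True
    then show ?thesis using p by (auto simp: l_def awalk_Nil_iff zero_prod_def)
  next
    case False
    then show ?thesis using walk_label[OF p(1)] by (simp add: l_def)
  qed
  \<comment> \<open>The slack between the weight of the walk and the radius.\<close>
  moreover have "(0, int (i - sum_list (map w p))) \<in> gen {(0 :: 'a, 1 :: int)}"
    unfolding gen_unit_weight by blast
  ultimately have "l + (0, int (i - sum_list (map w p))) \<in> ball_labels x (orbit L \<phi> y)"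
    unfolding ball_labels_def by (rule set_plus_intro)
  then show "(pos y - pos x, int i) \<in> ball_labels x (orbit L \<phi> y)"
    using p(2) by (simp add: l_def of_nat_diff)
qed

text \<open>In terms of displacements the \<open>L'\<close>-orbit of \<open>f\<close> is a coset, so
  its points within distance \<open>i\<close> correspond bijectively to the labels of weight
  \<open>i\<close> in a semilinear set cut by that coset.\<close>

lemma quasi_polynomial_ball_Int_orbit:
  assumes x: "x \<in> verts \<Gamma>" and f: "f \<in> verts \<Gamma>" and L': "subgroup L' L"
  defines "Z \<equiv> \<lambda>i::nat. {y \<in> {\<phi> u f | u. u \<in> L'}. graph_dist \<Gamma> w x y \<le> ereal (real i)}"
  shows "(\<forall>i. finite (Z i)) \<and> quasi_polynomial_type (\<lambda>i. of_nat (card (Z i)))"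
proof -
  have L'L: "u \<in> carrier L" if "u \<in> L'" for u using subgroup.subset[OF L'] that by blast
  \<comment> \<open>The full second factor leaves the weight unconstrained.\<close>
  define H where "H = h ` L' \<times> (UNIV :: int set)"
  have "add_subgroup H"
    unfolding add_subgroup_def
  proof (intro conjI ballI)
    show "0 \<in> H" using h_one subgroup.one_closed[OF L'] by (force simp: H_def zero_prod_def)
    fix a b assume "a \<in> H" "b \<in> H"
    then obtain u v where uv: "u \<in> L'" "v \<in> L'" "fst a = h u" "fst b = h v" by (auto simp: H_def)
    then have "fst (a - b) = h (u \<otimes>\<^bsub>L\<^esub> inv\<^bsub>L\<^esub> v)" using L'L by (simp add: h_mult h_m_inv)
    moreover have "u \<otimes>\<^bsub>L\<^esub> inv\<^bsub>L\<^esub> v \<in> L'"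
      using uv subgroup.m_closed[OF L'] subgroup.m_inv_closed[OF L'] by blast
    ultimately show "a - b \<in> H" by (auto simp: H_def mem_Times_iff)
  qed
  define X where "X = {l \<in> ball_labels x (orbit L \<phi> f). l - (pos f - pos x, 0) \<in> H}"
  have sl: "semilinear positive_labels X"
    unfolding X_def
    by (intro semilinear_Int_coset add_submonoid_positive_labels semilinear_ball_labels \<open>add_subgroup H\<close>)
  have XC: "X \<subseteq> positive_labels" by (rule semilinear_subset[OF add_submonoid_positive_labels sl])
  have qp: "quasi_polynomial_graded (\<lambda>l. nat (snd l)) X"
    by (rule quasi_polynomial_graded_semilinear[OF add_submonoid_positive_labels _ _ sl])
      (auto simp: positive_labels_def nat_add_distrib)
  have "bij_betw (\<lambda>y. (pos y - pos x, int i)) (Z i) {l \<in> X. nat (snd l) = i}" for i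
    unfolding bij_betw_def
  proof
    have orb: "\<phi> u f \<in> verts \<Gamma>" "orbit L \<phi> (\<phi> u f) = orbit L \<phi> f" if "u \<in> L'" for u
      using L'L[OF that] f by (auto simp: act_in_verts orbit_act)
    show "inj_on (\<lambda>y. (pos y - pos x, int i)) (Z i)"
    proof (rule inj_onI)
      fix y z assume "y \<in> Z i" "z \<in> Z i" "(pos y - pos x, int i) = (pos z - pos x, int i)"
      then show "y = z" using orb by (intro pos_inj) (auto simp: Z_def)
    qed
    show "(\<lambda>y. (pos y - pos x, int i)) ` Z i = {l \<in> X. nat (snd l) = i}"
    proof (intro equalityI subsetI)
      fix l assume "l \<in> (\<lambda>y. (pos y - pos x, int i)) ` Z i"
      then obtain u where u: "u \<in> L'" "l = (pos (\<phi> u f) - pos x, int i)"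
        "graph_dist \<Gamma> w x (\<phi> u f) \<le> ereal (real i)" by (auto simp: Z_def)
      then have "l \<in> ball_labels x (orbit L \<phi> f)"
        using mem_ball_labels_iff[OF x orb(1)[OF u(1)], of i] orb(2)[OF u(1)] by simp
      moreover have "l - (pos f - pos x, 0) \<in> H"
        using u(1) f L'L by (auto simp: u(2) pos_act H_def)
      ultimately show "l \<in> {l \<in> X. nat (snd l) = i}" by (simp add: X_def u(2))
    next
      fix l assume l: "l \<in> {l \<in> X. nat (snd l) = i}"
      \<comment> \<open>\<open>nat\<close> sends negative integers to \<open>0\<close>, so
        nonnegativity is needed to recover the weight.\<close>
      then have "snd l \<ge> 0" using XC by (auto simp: positive_labels_def)
      with l have "snd l = int i" by auto
      moreover obtain u where u: "u \<in> L'" "fst l - (pos f - pos x) = h u"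
        using l by (auto simp: X_def H_def mem_Times_iff)
      then have "fst l = pos (\<phi> u f) - pos x" using L'L f by (simp add: pos_act algebra_simps)
      ultimately have leq: "l = (pos (\<phi> u f) - pos x, int i)" by (simp add: prod_eq_iff)
      have "l \<in> ball_labels x (orbit L \<phi> (\<phi> u f))" using l orb(2)[OF u(1)] by (simp add: X_def)
      then have "graph_dist \<Gamma> w x (\<phi> u f) \<le> ereal (real i)"
        unfolding leq mem_ball_labels_iff[OF x orb(1)[OF u(1)]] .
      then have "\<phi> u f \<in> Z i" using u(1) by (auto simp: Z_def)
      with leq show "l \<in> (\<lambda>y. (pos y - pos x, int i)) ` Z i" by blast
    qed
  qed
  then have "finite (Z i) \<longleftrightarrow> finite {l \<in> X. nat (snd l) = i}"
    "card (Z i) = card {l \<in> X. nat (snd l) = i}" for i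
    using bij_betw_finite bij_betw_same_card by blast+
  with qp show ?thesis by (simp add: quasi_polynomial_graded_def)
qed

end

theorem theoremA3:
  fixes \<Gamma> :: "('v, 'e) pre_digraph"
    and w :: "'e \<Rightarrow> nat"
    and L :: "('l, 'm) monoid_scheme"
    and \<phi> :: "'l \<Rightarrow> 'v \<Rightarrow> 'v"
    and \<psi> :: "'l \<Rightarrow> 'e \<Rightarrow> 'e"
    and x\<^sub>0 :: 'v
    and L' :: "'l set"
    and V' :: "'v set"
  assumes "periodic_graph \<Gamma> w L \<phi> \<psi>"
    and "x\<^sub>0 \<in> verts \<Gamma>"
    and "subgroup L' L"
    and "fg_submodule \<Gamma> \<phi> L' V'"
  shows "(\<forall>i::nat. finite {y \<in> V'. graph_dist \<Gamma> w x\<^sub>0 y \<le> ereal (real i)}) \<and>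
    quasi_polynomial_type
      (\<lambda>i. of_nat (card {y \<in> V'. graph_dist \<Gamma> w x\<^sub>0 y \<le> ereal (real i)}))"
proof -
  interpret periodic_graph \<Gamma> w L \<phi> \<psi> by fact
  obtain h :: "'l \<Rightarrow> nat \<Rightarrow> int" where h: "inj_on h (carrier L)"
    "\<And>u v. u \<in> carrier L \<Longrightarrow> v \<in> carrier L \<Longrightarrow> h (u \<otimes>\<^bsub>L\<^esub> v) = h u + h v"
    using additive_embedding by blast
  obtain pos where pos: "\<And>u y. u \<in> carrier L \<Longrightarrow> y \<in> verts \<Gamma> \<Longrightarrow> pos (\<phi> u y) = h u + pos y"
    using position_function[OF h(2)] by blast
  interpret positioned_periodic_graph \<Gamma> w L \<phi> \<psi> h pos
    by unfold_locales (use h pos in auto)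
  obtain F where F: "finite F" "F \<subseteq> V'" "V' = {\<phi> u v | u v. u \<in> L' \<and> v \<in> F}"
    using assms(4) unfolding fg_submodule_def by (elim conjE exE)
  have "V' \<subseteq> verts \<Gamma>" using assms(4) unfolding fg_submodule_def by (elim conjE)
  with F(2) have FV: "F \<subseteq> verts \<Gamma>" by (rule order_trans)
  \<comment> \<open>As a set of orbits, \<open>\<O>\<close> lists an \<open>L'\<close>-orbit once
    even if several elements of \<open>F\<close> lie in it.\<close>
  define \<O> where "\<O> = (\<lambda>f. {\<phi> u f | u. u \<in> L'}) ` F"
  define Z where "Z B i = {y \<in> B. graph_dist \<Gamma> w x\<^sub>0 y \<le> ereal (real i)}" for B and i :: nat
  have L'L: "u \<in> carrier L" if "u \<in> L'" for u using subgroup.subset[OF assms(3)] that by blast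
  \<comment> \<open>One common point forces an inclusion; with the roles of \<open>f\<close> and
    \<open>g\<close> exchanged, orbits that meet coincide, and the counts of distinct ones add
    up.\<close>
  have sub: "{\<phi> u f | u. u \<in> L'} \<subseteq> {\<phi> u g | u. u \<in> L'}"
    if fg: "f \<in> F" "g \<in> F" "u \<in> L'" "v \<in> L'" "\<phi> u f = \<phi> v g" for f g u v
  proof
    fix y assume "y \<in> {\<phi> u f | u. u \<in> L'}"
    then obtain t where t: "t \<in> L'" "y = \<phi> t f" by blast
    have verts: "f \<in> verts \<Gamma>" "g \<in> verts \<Gamma>" using fg FV by auto
    have inv: "inv\<^bsub>L\<^esub> u \<in> L'" using subgroup.m_inv_closed[OF assms(3) fg(3)] .
    have "f = \<phi> (inv\<^bsub>L\<^esub> u) (\<phi> v g)"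
      using verts_action.orbit_sym_aux[OF L'L[OF fg(3)] verts(1) fg(5)] by simp
    then have "y = \<phi> (t \<otimes>\<^bsub>L\<^esub> (inv\<^bsub>L\<^esub> u \<otimes>\<^bsub>L\<^esub> v)) g"
      using t verts L'L[OF t(1)] L'L[OF inv] L'L[OF fg(4)]
      by (simp add: verts_action.composition_rule)
    moreover have "t \<otimes>\<^bsub>L\<^esub> (inv\<^bsub>L\<^esub> u \<otimes>\<^bsub>L\<^esub> v) \<in> L'"
      using t(1) inv fg(4) subgroup.m_closed[OF assms(3)] by blast
    ultimately show "y \<in> {\<phi> u g | u. u \<in> L'}" by blast
  qed
  have disj: "B \<inter> B' = {}" if B: "B \<in> \<O>" "B' \<in> \<O>" "B \<noteq> B'" for B B'
  proof (rule ccontr)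
    assume "B \<inter> B' \<noteq> {}"
    moreover obtain f g where "f \<in> F" "g \<in> F" "B = {\<phi> u f | u. u \<in> L'}" "B' = {\<phi> u g | u. u \<in> L'}"
      using B(1,2) by (auto simp: \<O>_def)
    moreover from calculation obtain u v where "u \<in> L'" "v \<in> L'" "\<phi> u f = \<phi> v g" by auto
    ultimately show False using sub[of f g u v] sub[of g f v u] B(3) by auto
  qed
  have fin\<O>: "finite \<O>" using F(1) by (simp add: \<O>_def)
  have Z: "(\<forall>i. finite (Z B i)) \<and> quasi_polynomial_type (\<lambda>i. of_nat (card (Z B i)))"
    if "B \<in> \<O>" for B
    using that quasi_polynomial_ball_Int_orbit[OF assms(2) _ assms(3)] FV
    unfolding \<O>_def Z_def by blast
  have ball: "{y \<in> V'. graph_dist \<Gamma> w x\<^sub>0 y \<le> ereal (real i)} = (\<Union>B\<in>\<O>. Z B i)" for i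
    unfolding F(3) \<O>_def Z_def by blast
  have "card (\<Union>B\<in>\<O>. Z B i) = (\<Sum>B\<in>\<O>. card (Z B i))" for i
  proof (rule card_UN_disjoint)
    show "\<forall>B\<in>\<O>. finite (Z B i)" using Z by blast
    show "\<forall>B\<in>\<O>. \<forall>B'\<in>\<O>. B \<noteq> B' \<longrightarrow> Z B i \<inter> Z B' i = {}"
      using disj unfolding Z_def by blast
  qed (rule fin\<O>)
  moreover have "quasi_polynomial_type (\<lambda>i. \<Sum>B\<in>\<O>. of_nat (card (Z B i)))"
    using fin\<O> Z by (intro quasi_polynomial_type_sum) auto
  ultimately show ?thesis
    unfolding ball using fin\<O> Z by simp
qed

end
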